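(* Let $0<\alpha<2$, let $X\in\mathcal B^\alpha_1([0,1],c(\cdot))$ be a locally stationary random process, and let $I(X)=\int_0^1X(t)\,dt$ be approximated by the stratified Monte Carlo quadrature $I_N(X,T_N)$, where $T_N$ is $RS(h)$. Then $$\lim_{N\to\infty}N^{1+\alpha}\|I(X)-I_N(X,T_N)\|^2=a_\alpha\int_0^1c(t)\,h(t)^{-(1+\alpha)}\,dt,\qquad a_\alpha:=\frac1{(1+\alpha)(2+\alpha)}.$$ The density minimizing the asymptotic constant is given by $$h_{opt}(t)=\frac{c(t)^\gamma}{\int_0^1c(\tau)^\gamma\,d\tau},\quad t\in[0,1],\qquad\gamma:=\frac1{2+\alpha},$$ and for this density $$\lim_{N\to\infty}N^{1+\alpha}\|I(X)-I_N(X,T_N)\|^2=a_\alpha\Bigl(\int_0^1c(t)^\gamma\,dt\Bigr)^{1/\gamma}.$$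
   Context: For a square-integrable random variable $\xi$, $\|\xi\|=(\mathrm E\,\xi^2)^{1/2}$. $X(t)$, $t\in[0,1]$, is a random process with finite second moments, continuous in quadratic mean (and taken jointly measurable). $X\in\mathcal B^\alpha_1([0,1],c(\cdot))$ (locally stationary) means that $c$ is a positive continuous function on $[0,1]$ and $$\frac{\|X(t+s)-X(t)\|^2}{c(t)|s|^\alpha}\to1\quad\text{as }s\to0,\text{ uniformly in }t\in[0,1]$$ (with $t,t+s\in[0,1]$). $T_N$ is $RS(h)$ (regular sequence of designs): $h$ is a positive continuous probability density on $[0,1]$ and the grid points $0=t_0<t_1<\dots<t_N=1$ are defined by $\int_0^{t_i}h(v)\,dv=i/N$, $i=0,\dots,N$. Quadrature: $I_N(X,T_N)=\sum_{i=0}^{N-1}X(\eta_i)(t_{i+1}-t_i)$, where $\eta_i$ is uniformly distributed on $[t_i,t_{i+1}]$, the $\eta_i$ being mutually independent and independent of $X$. The error $\|I(X)-I_N(X,T_N)\|^2$ is the expectation over both $X$ and the $\eta_i$. Minimization is over positive continuous densities $h$ on $[0,1]$. *)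

theory Defs
  imports "HOL-Probability.Probability"
begin

definition l2_norm :: "'a measure \<Rightarrow> ('a \<Rightarrow> real) \<Rightarrow> real" where
  "l2_norm M \<xi> = sqrt (LINT \<omega>|M. (\<xi> \<omega>)\<^sup>2)"

(* Joint measurability is taken with respect to an explicit sigma-algebra F on the sample
   space, because independence of the sampling points (see stratified_points) refers to it. *)
definition jointly_measurable :: "'a measure \<Rightarrow> (real \<Rightarrow> 'a \<Rightarrow> real) \<Rightarrow> bool" where
  "jointly_measurable F X \<longleftrightarrow>
     (\<lambda>(t, \<omega>). X t \<omega>) \<in> borel_measurable (restrict_space borel {0..1} \<Otimes>\<^sub>M F)"

definition qm_continuous_process :: "'a measure \<Rightarrow> (real \<Rightarrow> 'a \<Rightarrow> real) \<Rightarrow> bool" where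
  "qm_continuous_process M X \<longleftrightarrow>
     jointly_measurable M X \<and>
     (\<forall>t\<in>{0..1}. integrable M (\<lambda>\<omega>. (X t \<omega>)\<^sup>2)) \<and>
     (\<forall>t\<in>{0..1}. ((\<lambda>s. l2_norm M (\<lambda>\<omega>. X s \<omega> - X t \<omega>)) \<longlongrightarrow> 0) (at t within {0..1}))"

definition locally_stationary ::
  "'a measure \<Rightarrow> (real \<Rightarrow> 'a \<Rightarrow> real) \<Rightarrow> real \<Rightarrow> (real \<Rightarrow> real) \<Rightarrow> bool" where
  "locally_stationary M X \<alpha> c \<longleftrightarrow>
     continuous_on {0..1} c \<and> (\<forall>t\<in>{0..1}. 0 < c t) \<and>
     (\<forall>\<epsilon>>0. \<exists>\<delta>>0. \<forall>t s. t \<in> {0..1} \<longrightarrow> t + s \<in> {0..1} \<longrightarrow> 0 < \<bar>s\<bar> \<longrightarrow> \<bar>s\<bar> < \<delta> \<longrightarrow>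
        \<bar>(l2_norm M (\<lambda>\<omega>. X (t + s) \<omega> - X t \<omega>))\<^sup>2 / (c t * \<bar>s\<bar> powr \<alpha>) - 1\<bar> < \<epsilon>)"

definition positive_density :: "(real \<Rightarrow> real) \<Rightarrow> bool" where
  "positive_density h \<longleftrightarrow>
     continuous_on {0..1} h \<and> (\<forall>t\<in>{0..1}. 0 < h t) \<and> (LBINT v:{0..1}. h v) = 1"

definition regular_design :: "(real \<Rightarrow> real) \<Rightarrow> nat \<Rightarrow> (nat \<Rightarrow> real) \<Rightarrow> bool" where
  "regular_design h N t \<longleftrightarrow>
     t 0 = 0 \<and> t N = 1 \<and> (\<forall>i<N. t i < t (Suc i)) \<and>
     (\<forall>i\<le>N. (LBINT v:{0..t i}. h v) = real i / real N)"

definition regular_designs :: "(real \<Rightarrow> real) \<Rightarrow> (nat \<Rightarrow> nat \<Rightarrow> real) \<Rightarrow> bool" where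
  "regular_designs h T \<longleftrightarrow> positive_density h \<and> (\<forall>N\<ge>1. regular_design h N (T N))"

(* Independence of the points from the process X is independence from a sigma-algebra F for
   which X is jointly measurable. Independence from the sigma-algebra generated by the single
   variables X t would not determine the law of X at a random point: replacing X t \<omega> by
   X t \<omega> + (if t = \<eta> 0 \<omega> then 1 else 0) changes each X t only on a null set.
   The points lie in their intervals everywhere, not just almost surely, since the process
   is only meaningful on [0,1]. *)
definition stratified_points ::
  "'a measure \<Rightarrow> (real \<Rightarrow> 'a \<Rightarrow> real) \<Rightarrow> nat \<Rightarrow> (nat \<Rightarrow> real) \<Rightarrow> (nat \<Rightarrow> 'a \<Rightarrow> real) \<Rightarrow> bool" where
  "stratified_points M X N t \<eta> \<longleftrightarrow>
     (\<forall>i<N. \<eta> i \<in> borel_measurable M \<and>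
        (\<forall>\<omega>\<in>space M. \<eta> i \<omega> \<in> {t i..t (Suc i)}) \<and>
        distr M lborel (\<eta> i) = uniform_measure lborel {t i..t (Suc i)}) \<and>
     prob_space.indep_vars M (\<lambda>_. borel) \<eta> {..<N} \<and>
     (\<exists>F. subalgebra M F \<and> jointly_measurable F X \<and>
        prob_space.indep_set M (sets F)
          (sets (vimage_algebra (space M) (\<lambda>\<omega>. \<lambda>i\<in>{..<N}. \<eta> i \<omega>) (Pi\<^sub>M {..<N} (\<lambda>_. borel)))))"

definition process_integral :: "(real \<Rightarrow> 'a \<Rightarrow> real) \<Rightarrow> 'a \<Rightarrow> real" where
  "process_integral X \<omega> = (LBINT t:{0..1}. X t \<omega>)"

definition quadrature ::
  "(real \<Rightarrow> 'a \<Rightarrow> real) \<Rightarrow> nat \<Rightarrow> (nat \<Rightarrow> real) \<Rightarrow> (nat \<Rightarrow> 'a \<Rightarrow> real) \<Rightarrow> 'a \<Rightarrow> real" where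
  "quadrature X N t \<eta> \<omega> = (\<Sum>i<N. X (\<eta> i \<omega>) \<omega> * (t (Suc i) - t i))"

definition mean_square_error ::
  "'a measure \<Rightarrow> (real \<Rightarrow> 'a \<Rightarrow> real) \<Rightarrow> nat \<Rightarrow> (nat \<Rightarrow> real) \<Rightarrow> (nat \<Rightarrow> 'a \<Rightarrow> real) \<Rightarrow> real" where
  "mean_square_error M X N t \<eta> =
     (l2_norm M (\<lambda>\<omega>. process_integral X \<omega> - quadrature X N t \<eta> \<omega>))\<^sup>2"

definition a_const :: "real \<Rightarrow> real" where
  "a_const \<alpha> = 1 / ((1 + \<alpha>) * (2 + \<alpha>))"

definition asymptotic_constant :: "real \<Rightarrow> (real \<Rightarrow> real) \<Rightarrow> (real \<Rightarrow> real) \<Rightarrow> real" where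
  "asymptotic_constant \<alpha> c h = a_const \<alpha> * (LBINT t:{0..1}. c t * h t powr (- (1 + \<alpha>)))"

definition opt_exponent :: "real \<Rightarrow> real" where
  "opt_exponent \<alpha> = 1 / (2 + \<alpha>)"

definition opt_density :: "real \<Rightarrow> (real \<Rightarrow> real) \<Rightarrow> real \<Rightarrow> real" where
  "opt_density \<alpha> c t =
     c t powr opt_exponent \<alpha> / (LBINT \<tau>:{0..1}. c \<tau> powr opt_exponent \<alpha>)"

end

theory Submission
  imports Defs
begin

text \<open>
  Given the process, the sampled cells are independent, and the contribution of each cell to the
  error is centred. Hence the cross terms vanish, and a cell of length \<open>\<Delta>\<close> contributes
  \<open>\<Delta>\<^sup>2\<close> times the mean variance of the path on it, that is, half the integral of
  \<open>E (X s - X t)\<^sup>2\<close> over the square of the cell. By local stationarity this is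
  \<open>a_const \<alpha> * c(t_i) * \<Delta> powr (2 + \<alpha>)\<close> up to a uniformly small relative error. The mean value
  theorem gives \<open>h(\<xi>_i) * \<Delta> = 1/N\<close> for some \<open>\<xi>_i\<close> in the cell, so after multiplication by
  \<open>N powr (1 + \<alpha>)\<close> the sum of the contributions is a Riemann sum of the asymptotic constant.

  For the minimization write \<open>c = C * q powr (2 + \<alpha>)\<close>, where \<open>q\<close> is the optimal density and \<open>C\<close> a
  constant. The functional becomes the integral of \<open>h * (q / h) powr (2 + \<alpha>)\<close>, and Bernoulli's
  inequality \<open>x powr p \<ge> 1 + p * (x - 1)\<close>, strict for \<open>x \<noteq> 1\<close>, bounds it below by 1 with equality
  only for \<open>h = q\<close>.
\<close>

section \<open>Conditional variance of a sampled field\<close>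

lemma integrable_mult_if_square_integrable:
  fixes f g :: "'a \<Rightarrow> real"
  assumes [measurable]: "f \<in> borel_measurable M" "g \<in> borel_measurable M"
    and "integrable M (\<lambda>x. (f x)\<^sup>2)" "integrable M (\<lambda>x. (g x)\<^sup>2)"
  shows "integrable M (\<lambda>x. f x * g x)"
proof (rule Bochner_Integration.integrable_bound)
  show "integrable M (\<lambda>x. (f x)\<^sup>2 + (g x)\<^sup>2)"
    using assms by simp
  have "\<bar>f x * g x\<bar> \<le> (f x)\<^sup>2 + (g x)\<^sup>2" for x
    using sum_squares_bound[of "\<bar>f x\<bar>" "\<bar>g x\<bar>"] abs_ge_zero[of "f x * g x"]
    unfolding abs_mult power2_abs mult.assoc by linarith
  then show "AE x in M. norm (f x * g x) \<le> norm ((f x)\<^sup>2 + (g x)\<^sup>2)"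
    by simp
  show "(\<lambda>x. f x * g x) \<in> borel_measurable M"
    by measurable
qed

lemma (in prob_space) integrable_if_square_integrable:
  fixes f :: "'a \<Rightarrow> real"
  assumes "f \<in> borel_measurable M" "integrable M (\<lambda>x. (f x)\<^sup>2)"
  shows "integrable M f"
proof -
  have "integrable M (\<lambda>x. f x * 1)"
    using assms by (intro integrable_mult_if_square_integrable) auto
  then show ?thesis by simp
qed

text \<open>Expand the square and use that the total mass is 1. Applied to a path under the law of a
  sampling point, this expresses its variance through increments, the quantity that local
  stationarity controls.\<close>

lemma (in prob_space) double_integral_square_diff:
  fixes f :: "'a \<Rightarrow> real"
  assumes [measurable]: "f \<in> borel_measurable M" and f2: "integrable M (\<lambda>x. (f x)\<^sup>2)"
  shows "(\<integral>x. (\<integral>y. (f x - f y)\<^sup>2 \<partial>M) \<partial>M) = 2 * variance f"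
proof -
  note f = integrable_if_square_integrable[OF assms]
  have "(\<integral>y. (f x - f y)\<^sup>2 \<partial>M) = (f x)\<^sup>2 - 2 * f x * expectation f + expectation (\<lambda>y. (f y)\<^sup>2)" for x
    using f f2 by (simp add: power2_diff prob_space)
  then have "(\<integral>x. (\<integral>y. (f x - f y)\<^sup>2 \<partial>M) \<partial>M) = 2 * expectation (\<lambda>y. (f y)\<^sup>2) - 2 * (expectation f)\<^sup>2"
    using f f2 by (simp add: prob_space power2_eq_square)
  then show ?thesis
    using variance_eq[OF f f2] by simp
qed

text \<open>Independence of the points from the process is given for families of events, whereas
  Fubini needs a product law. It suffices to compare both measures on rectangles, where
  \<open>indep_setD\<close> applies since the two preimages lie in the independent families.\<close>

lemma (in prob_space) indep_set_product_law:
  assumes rv[measurable]: "random_variable S A" "random_variable T C"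
    and ind: "indep_set \<A> \<C>"
    and "\<And>P. P \<in> sets S \<Longrightarrow> A -` P \<inter> space M \<in> \<A>"
    and "\<And>Q. Q \<in> sets T \<Longrightarrow> C -` Q \<inter> space M \<in> \<C>"
  shows "distr M S A \<Otimes>\<^sub>M distr M T C = distr M (S \<Otimes>\<^sub>M T) (\<lambda>x. (A x, C x))"
proof (rule pair_measure_eqI)
  interpret S: prob_space "distr M S A" by (rule prob_space_distr) measurable
  interpret T: prob_space "distr M T C" by (rule prob_space_distr) measurable
  show "sigma_finite_measure (distr M S A)" "sigma_finite_measure (distr M T C)" by unfold_locales
next
  fix P Q assume "P \<in> sets (distr M S A)" "Q \<in> sets (distr M T C)"
  then have PQ[measurable]: "P \<in> sets S" "Q \<in> sets T" by auto
  have "(\<lambda>x. (A x, C x)) -` (P \<times> Q) \<inter> space M = (A -` P \<inter> space M) \<inter> (C -` Q \<inter> space M)"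
    by auto
  moreover have "prob ((A -` P \<inter> space M) \<inter> (C -` Q \<inter> space M)) = prob (A -` P \<inter> space M) * prob (C -` Q \<inter> space M)"
    by (rule indep_setD[OF ind]) (use assms PQ in auto)
  ultimately show "emeasure (distr M S A) P * emeasure (distr M T C) Q
      = emeasure (distr M (S \<Otimes>\<^sub>M T) (\<lambda>x. (A x, C x))) (P \<times> Q)"
    by (simp add: emeasure_distr emeasure_eq_measure ennreal_mult)
next
  show "sets (distr M S A \<Otimes>\<^sub>M distr M T C) = sets (distr M (S \<Otimes>\<^sub>M T) (\<lambda>x. (A x, C x)))"
    unfolding sets_distr by (rule sets_pair_measure_cong) simp_all
qed

text \<open>Fubini for the joint law: freezing \<open>A \<omega>\<close> and integrating over the
  law of \<open>C\<close> is a concrete form of conditioning on \<open>A\<close>. The second claim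
  is needed when the inner integral is itself over a product and has to be split again.\<close>

lemma (in prob_space) integral_product_law:
  fixes g :: "'b \<times> 'c \<Rightarrow> real"
  assumes rv[measurable]: "random_variable S A" "random_variable T C"
    and eq: "distr M S A \<Otimes>\<^sub>M distr M T C = distr M (S \<Otimes>\<^sub>M T) (\<lambda>x. (A x, C x))"
    and g: "g \<in> borel_measurable (S \<Otimes>\<^sub>M T)"
    and int: "integrable M (\<lambda>\<omega>. g (A \<omega>, C \<omega>))"
  shows "(\<integral>\<omega>. g (A \<omega>, C \<omega>) \<partial>M) = (\<integral>\<omega>. (\<integral>y. g (A \<omega>, y) \<partial>distr M T C) \<partial>M)"
    and "AE \<omega> in M. integrable (distr M T C) (\<lambda>y. g (A \<omega>, y))"
proof -
  note [measurable] = g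
  interpret S: prob_space "distr M S A" by (rule prob_space_distr) measurable
  interpret T: prob_space "distr M T C" by (rule prob_space_distr) measurable
  interpret ST: pair_prob_space "distr M S A" "distr M T C" ..
  have i: "integrable (distr M S A \<Otimes>\<^sub>M distr M T C) g"
    unfolding eq using int by (simp add: integrable_distr_eq)
  have "(\<integral>\<omega>. g (A \<omega>, C \<omega>) \<partial>M) = integral\<^sup>L (distr M S A \<Otimes>\<^sub>M distr M T C) g"
    unfolding eq by (simp add: integral_distr)
  also have "\<dots> = (\<integral>x. (\<integral>y. g (x, y) \<partial>distr M T C) \<partial>distr M S A)"
    using ST.integral_fst'[OF i] by simp
  also have "\<dots> = (\<integral>\<omega>. (\<integral>y. g (A \<omega>, y) \<partial>distr M T C) \<partial>M)"
    by (subst integral_distr[where N=S]) (auto intro!: T.borel_measurable_lebesgue_integral)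
  finally show "(\<integral>\<omega>. g (A \<omega>, C \<omega>) \<partial>M) = (\<integral>\<omega>. (\<integral>y. g (A \<omega>, y) \<partial>distr M T C) \<partial>M)" .
  have "AE x in distr M S A. integrable (distr M T C) (\<lambda>y. g (x, y))"
    using ST.AE_integrable_fst'[OF i] .
  then show "AE \<omega> in M. integrable (distr M T C) (\<lambda>y. g (A \<omega>, y))"
    by (rule AE_distrD[rotated]) measurable
qed

text \<open>Tonelli in the other order: here the value of \<open>C\<close> is frozen and the average
  over \<omega> is taken first. Integrability is not presupposed, so this can serve to establish
  it.\<close>

lemma (in prob_space) nn_integral_product_law:
  assumes rv[measurable]: "random_variable S A" "random_variable T C"
    and eq: "distr M S A \<Otimes>\<^sub>M distr M T C = distr M (S \<Otimes>\<^sub>M T) (\<lambda>x. (A x, C x))"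
    and g: "g \<in> borel_measurable (S \<Otimes>\<^sub>M T)"
  shows "(\<integral>\<^sup>+\<omega>. g (A \<omega>, C \<omega>) \<partial>M) = (\<integral>\<^sup>+y. (\<integral>\<^sup>+\<omega>. g (A \<omega>, y) \<partial>M) \<partial>distr M T C)"
proof -
  note [measurable] = g
  interpret S: prob_space "distr M S A" by (rule prob_space_distr) measurable
  interpret T: prob_space "distr M T C" by (rule prob_space_distr) measurable
  interpret ST: pair_prob_space "distr M S A" "distr M T C" ..
  have "(\<integral>\<^sup>+\<omega>. g (A \<omega>, C \<omega>) \<partial>M) = integral\<^sup>N (distr M S A \<Otimes>\<^sub>M distr M T C) g"
    unfolding eq by (simp add: nn_integral_distr)
  also have "\<dots> = (\<integral>\<^sup>+y. (\<integral>\<^sup>+x. g (x, y) \<partial>distr M S A) \<partial>distr M T C)"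
    by (subst ST.nn_integral_snd[symmetric]) auto
  also have "\<dots> = (\<integral>\<^sup>+y. (\<integral>\<^sup>+\<omega>. g (A \<omega>, y) \<partial>M) \<partial>distr M T C)"
    by (intro nn_integral_cong, subst nn_integral_distr[OF rv(1)]) auto
  finally show ?thesis .
qed

text \<open>Time runs over the whole line, so that plain \<open>borel\<close> is the space of times.
  \<open>F\<close> plays the part of the sigma-algebra from which the sampling points will be
  independent, and the uniform bound \<open>B\<close> makes averages over arbitrary laws of times
  finite.\<close>

locale square_integrable_field = prob_space +
  fixes F :: "'a measure" and X :: "real \<Rightarrow> 'a \<Rightarrow> real" and B :: real
  assumes subalg: "subalgebra M F"
    and X_meas_F: "(\<lambda>(t, \<omega>). X t \<omega>) \<in> borel_measurable (borel \<Otimes>\<^sub>M F)"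
    and X_square_integrable: "\<And>t. integrable M (\<lambda>\<omega>. (X t \<omega>)\<^sup>2)"
    and X_second_moment_le: "\<And>t. expectation (\<lambda>\<omega>. (X t \<omega>)\<^sup>2) \<le> B"
begin

text \<open>The identity turns the sigma-algebra \<open>F\<close> into a random variable, so that
  independence of \<open>F\<close> and a point becomes a product law for the pair of \<omega> and
  the point.\<close>

lemma ident_measurable_F: "(\<lambda>\<omega>. \<omega>) \<in> measurable M F"
  using subalg by (auto simp: measurable_def subalgebra_def)

lemma X_measurable: "(\<lambda>(t, \<omega>). X t \<omega>) \<in> borel_measurable (borel \<Otimes>\<^sub>M M)"
proof -
  have [measurable]: "(\<lambda>z. snd z) \<in> measurable (borel \<Otimes>\<^sub>M M) F"
    by (rule measurable_compose[OF measurable_snd ident_measurable_F])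
  have "(\<lambda>z. (fst z, snd z)) \<in> measurable (borel \<Otimes>\<^sub>M M) (borel \<Otimes>\<^sub>M F)"
    by measurable
  from measurable_compose[OF this X_meas_F] show ?thesis
    by (simp add: case_prod_unfold)
qed

lemma X_measurable_comp:
  assumes [measurable]: "f \<in> borel_measurable N" "g \<in> measurable N M"
  shows "(\<lambda>x. X (f x) (g x)) \<in> borel_measurable N"
proof -
  have "(\<lambda>x. (f x, g x)) \<in> measurable N (borel \<Otimes>\<^sub>M M)" by measurable
  from measurable_compose[OF this X_measurable] show ?thesis by simp
qed

lemma X_measurable_comp_F:
  assumes [measurable]: "f \<in> borel_measurable N" "g \<in> measurable N F"
  shows "(\<lambda>x. X (f x) (g x)) \<in> borel_measurable N"
proof -
  have "(\<lambda>x. (f x, g x)) \<in> measurable N (borel \<Otimes>\<^sub>M F)" by measurable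
  from measurable_compose[OF this X_meas_F] show ?thesis by simp
qed

lemma nn_second_moment_le: "(\<integral>\<^sup>+\<omega>. ennreal ((X t \<omega>)\<^sup>2) \<partial>M) \<le> ennreal B"
  using X_second_moment_le X_square_integrable by (simp add: nn_integral_eq_integral ennreal_leI)

lemma integrable_X_square_pair:
  assumes "prob_space U" "sets U = sets borel"
  shows "integrable (U \<Otimes>\<^sub>M M) (\<lambda>z. (X (fst z) (snd z))\<^sup>2)"
proof -
  interpret U: prob_space U by fact
  note [measurable_cong] = assms(2)
  note [measurable] = X_measurable_comp
  have "(\<integral>\<^sup>+z. ennreal ((X (fst z) (snd z))\<^sup>2) \<partial>(U \<Otimes>\<^sub>M M)) = (\<integral>\<^sup>+t. \<integral>\<^sup>+\<omega>. ennreal ((X t \<omega>)\<^sup>2) \<partial>M \<partial>U)"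
    by (subst nn_integral_fst[symmetric]) auto
  also have "\<dots> \<le> (\<integral>\<^sup>+t. ennreal B \<partial>U)"
    by (intro nn_integral_mono nn_second_moment_le)
  also have "\<dots> < \<infinity>" by (simp add: U.emeasure_space_1)
  finally show ?thesis
    by (intro integrableI_bounded) auto
qed

text \<open>Fubini read along paths instead of times. Individual paths are square integrable only
  almost surely, which is why the later pathwise identities carry an \<open>AE\<close>.\<close>

lemma AE_path_square_integrable:
  assumes "prob_space U" "sets U = sets borel"
  shows "AE \<omega> in M. integrable U (\<lambda>t. (X t \<omega>)\<^sup>2)"
    and "integrable M (\<lambda>\<omega>. \<integral>t. (X t \<omega>)\<^sup>2 \<partial>U)"
    and "AE \<omega> in M. (\<lambda>t. X t \<omega>) \<in> borel_measurable U \<and> integrable U (\<lambda>t. X t \<omega>)"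
proof -
  interpret U: prob_space U by fact
  interpret UM: pair_prob_space U M ..
  note [measurable_cong] = assms(2)
  note [measurable] = X_measurable_comp
  have int: "integrable (U \<Otimes>\<^sub>M M) (\<lambda>(t, \<omega>). (X t \<omega>)\<^sup>2)"
    using integrable_X_square_pair[OF assms] by (simp only: case_prod_unfold)
  show *: "AE \<omega> in M. integrable U (\<lambda>t. (X t \<omega>)\<^sup>2)"
    using UM.AE_integrable_snd[OF int] .
  show "integrable M (\<lambda>\<omega>. \<integral>t. (X t \<omega>)\<^sup>2 \<partial>U)"
    using UM.integrable_snd[OF int] .
  show "AE \<omega> in M. (\<lambda>t. X t \<omega>) \<in> borel_measurable U \<and> integrable U (\<lambda>t. X t \<omega>)"
    using * AE_space
  proof eventually_elim
    case (elim \<omega>)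
    then have "(\<lambda>t. X t \<omega>) \<in> borel_measurable U" by measurable
    then show ?case using elim U.integrable_if_square_integrable by blast
  qed
qed

text \<open>This serves as the conditional expectation, given \<open>F\<close>, of the field at a
  point that has law \<open>U\<close> and is independent of \<open>F\<close>.\<close>

definition path_mean :: "real measure \<Rightarrow> 'a \<Rightarrow> real" where
  "path_mean U \<omega> = (\<integral>t. X t \<omega> \<partial>U)"

text \<open>Measurability with respect to \<open>F\<close>, and not merely \<open>M\<close>, makes
  the path mean a function of the first component in the product laws with \<open>F\<close>.\<close>

lemma path_mean_measurable:
  assumes "prob_space U" "sets U = sets borel"
  shows "path_mean U \<in> borel_measurable F"
proof -
  interpret U: prob_space U by fact
  note [measurable_cong] = assms(2)
  note [measurable] = X_measurable_comp_F
  show ?thesis unfolding path_mean_def by measurable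
qed

text \<open>Jensen's inequality for the square along almost every path, in the form that a variance
  is nonnegative.\<close>

lemma path_mean_square_integrable:
  assumes U: "prob_space U" "sets U = sets borel"
  shows "integrable M (\<lambda>\<omega>. (path_mean U \<omega>)\<^sup>2)"
proof (rule Bochner_Integration.integrable_bound)
  interpret U: prob_space U by fact
  show "integrable M (\<lambda>\<omega>. \<integral>t. (X t \<omega>)\<^sup>2 \<partial>U)"
    by (rule AE_path_square_integrable[OF U])
  show "(\<lambda>\<omega>. (path_mean U \<omega>)\<^sup>2) \<in> borel_measurable M"
    using measurable_compose[OF ident_measurable_F path_mean_measurable[OF U]] by measurable
  show "AE \<omega> in M. norm ((path_mean U \<omega>)\<^sup>2) \<le> norm (\<integral>t. (X t \<omega>)\<^sup>2 \<partial>U)"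
    using AE_path_square_integrable(1,3)[OF U]
  proof eventually_elim
    case (elim \<omega>)
    then have "0 \<le> (\<integral>t. (X t \<omega>)\<^sup>2 \<partial>U) - (path_mean U \<omega>)\<^sup>2"
      using U.variance_eq[of "\<lambda>t. X t \<omega>"] U.variance_positive[of "\<lambda>t. X t \<omega>"] by (simp add: path_mean_def)
    then show ?case by simp
  qed
qed

text \<open>This justifies exchanging the double time integral with the expectation. The increment
  is dominated by the second moments at its two times, each at most \<open>B\<close>.\<close>

lemma integrable_increment_square:
  assumes U: "prob_space U" "sets U = sets borel"
  shows "integrable ((U \<Otimes>\<^sub>M U) \<Otimes>\<^sub>M M) (\<lambda>(z, \<omega>). (X (fst z) \<omega> - X (snd z) \<omega>)\<^sup>2)"
proof -
  interpret U: prob_space U by fact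
  interpret UU: pair_prob_space U U ..
  note [measurable_cong] = U(2)
  note [measurable] = X_measurable_comp
  have meas: "(\<lambda>z. ennreal ((X (fst (fst z)) (snd z) - X (snd (fst z)) (snd z))\<^sup>2)) \<in> borel_measurable ((U \<Otimes>\<^sub>M U) \<Otimes>\<^sub>M M)"
    by measurable
  have "(\<integral>\<^sup>+z. ennreal ((X (fst (fst z)) (snd z) - X (snd (fst z)) (snd z))\<^sup>2) \<partial>((U \<Otimes>\<^sub>M U) \<Otimes>\<^sub>M M))
     = (\<integral>\<^sup>+t. \<integral>\<^sup>+\<omega>. ennreal ((X (fst t) \<omega> - X (snd t) \<omega>)\<^sup>2) \<partial>M \<partial>(U \<Otimes>\<^sub>M U))"
    using nn_integral_fst[OF meas] by simp
  also have "\<dots> \<le> (\<integral>\<^sup>+t. 2 * ennreal B + 2 * ennreal B \<partial>(U \<Otimes>\<^sub>M U))"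
  proof (rule nn_integral_mono)
    fix t :: "real \<times> real"
    have "(\<integral>\<^sup>+\<omega>. ennreal ((X (fst t) \<omega> - X (snd t) \<omega>)\<^sup>2) \<partial>M)
       \<le> (\<integral>\<^sup>+\<omega>. 2 * ennreal ((X (fst t) \<omega>)\<^sup>2) + 2 * ennreal ((X (snd t) \<omega>)\<^sup>2) \<partial>M)"
    proof (rule nn_integral_mono)
      fix \<omega>
      \<comment> \<open>After expansion this says that the square of the sum is nonnegative.\<close>
      have le: "(X (fst t) \<omega> - X (snd t) \<omega>)\<^sup>2 \<le> 2 * (X (fst t) \<omega>)\<^sup>2 + 2 * (X (snd t) \<omega>)\<^sup>2"
        using zero_le_power2[of "X (fst t) \<omega> + X (snd t) \<omega>"] unfolding power2_diff power2_sum by linarith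
      then show "ennreal ((X (fst t) \<omega> - X (snd t) \<omega>)\<^sup>2) \<le> 2 * ennreal ((X (fst t) \<omega>)\<^sup>2) + 2 * ennreal ((X (snd t) \<omega>)\<^sup>2)"
        using ennreal_leI[OF le] by (simp add: ennreal_mult)
    qed
    also have "\<dots> = 2 * (\<integral>\<^sup>+\<omega>. ennreal ((X (fst t) \<omega>)\<^sup>2) \<partial>M) + 2 * (\<integral>\<^sup>+\<omega>. ennreal ((X (snd t) \<omega>)\<^sup>2) \<partial>M)"
      by (simp add: nn_integral_add nn_integral_cmult)
    also have "\<dots> \<le> 2 * ennreal B + 2 * ennreal B"
      by (intro add_mono mult_left_mono nn_second_moment_le) auto
    finally show "(\<integral>\<^sup>+\<omega>. ennreal ((X (fst t) \<omega> - X (snd t) \<omega>)\<^sup>2) \<partial>M) \<le> 2 * ennreal B + 2 * ennreal B" .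
  qed
  also have "\<dots> < \<infinity>" by (simp add: UU.emeasure_space_1 ennreal_mult_less_top)
  finally show ?thesis
    by (intro integrableI_bounded) (auto simp: split_beta')
qed

text \<open>For almost every path this is \<open>double_integral_square_diff\<close> under the law
  \<open>U\<close>; Fubini then moves the expectation inside the double time integral.\<close>

lemma mean_path_variance:
  assumes U: "prob_space U" "sets U = sets borel"
  shows "(\<integral>\<omega>. (\<integral>t. (path_mean U \<omega> - X t \<omega>)\<^sup>2 \<partial>U) \<partial>M)
     = (\<integral>z. (\<integral>\<omega>. (X (fst z) \<omega> - X (snd z) \<omega>)\<^sup>2 \<partial>M) \<partial>(U \<Otimes>\<^sub>M U)) / 2"
    and "integrable (U \<Otimes>\<^sub>M U) (\<lambda>z. \<integral>\<omega>. (X (fst z) \<omega> - X (snd z) \<omega>)\<^sup>2 \<partial>M)"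
proof -
  interpret U: prob_space U by fact
  interpret UU: pair_prob_space U U ..
  interpret UUM: pair_prob_space "U \<Otimes>\<^sub>M U" M ..
  note [measurable_cong] = U(2)
  note [measurable] = X_measurable_comp path_mean_measurable[OF U]
  note int = integrable_increment_square[OF U]
  show "integrable (U \<Otimes>\<^sub>M U) (\<lambda>z. \<integral>\<omega>. (X (fst z) \<omega> - X (snd z) \<omega>)\<^sup>2 \<partial>M)"
    using UUM.integrable_fst[OF int] .
  have "(\<integral>z. (\<integral>\<omega>. (X (fst z) \<omega> - X (snd z) \<omega>)\<^sup>2 \<partial>M) \<partial>(U \<Otimes>\<^sub>M U))
    = (\<integral>\<omega>. (\<integral>z. (X (fst z) \<omega> - X (snd z) \<omega>)\<^sup>2 \<partial>(U \<Otimes>\<^sub>M U)) \<partial>M)"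
    using UUM.Fubini_integral[OF int] by simp
  also have "\<dots> = (\<integral>\<omega>. 2 * (\<integral>t. (path_mean U \<omega> - X t \<omega>)\<^sup>2 \<partial>U) \<partial>M)"
  proof (rule integral_cong_AE)
    show "AE \<omega> in M. (\<integral>z. (X (fst z) \<omega> - X (snd z) \<omega>)\<^sup>2 \<partial>(U \<Otimes>\<^sub>M U)) = 2 * (\<integral>t. (path_mean U \<omega> - X t \<omega>)\<^sup>2 \<partial>U)"
      using UUM.AE_integrable_snd[OF int] AE_path_square_integrable(1,3)[OF U]
    proof eventually_elim
      case (elim \<omega>)
      have "(\<integral>z. (X (fst z) \<omega> - X (snd z) \<omega>)\<^sup>2 \<partial>(U \<Otimes>\<^sub>M U)) = (\<integral>s. \<integral>t. (X s \<omega> - X t \<omega>)\<^sup>2 \<partial>U \<partial>U)"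
        using UU.integral_fst'[OF elim(1)] by simp
      also have "\<dots> = 2 * U.variance (\<lambda>t. X t \<omega>)"
        by (rule U.double_integral_square_diff) (use elim in auto)
      finally show ?case
        by (simp add: path_mean_def power2_commute)
    qed
    have [measurable]: "path_mean U \<in> borel_measurable M"
      by (rule measurable_compose[OF ident_measurable_F path_mean_measurable[OF U]])
    show "(\<lambda>\<omega>. 2 * (\<integral>t. (path_mean U \<omega> - X t \<omega>)\<^sup>2 \<partial>U)) \<in> borel_measurable M"
      by measurable
    show "(\<lambda>\<omega>. \<integral>z. (X (fst z) \<omega> - X (snd z) \<omega>)\<^sup>2 \<partial>(U \<Otimes>\<^sub>M U)) \<in> borel_measurable M"
      by measurable
  qed
  finally show "(\<integral>\<omega>. (\<integral>t. (path_mean U \<omega> - X t \<omega>)\<^sup>2 \<partial>U) \<partial>M)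
     = (\<integral>z. (\<integral>\<omega>. (X (fst z) \<omega> - X (snd z) \<omega>)\<^sup>2 \<partial>M) \<partial>(U \<Otimes>\<^sub>M U)) / 2"
    by simp
qed

end

section \<open>Uniform laws on intervals and integrals over a partition\<close>

lemma density_uniform_measure_Icc:
  fixes a b :: real
  assumes "a < b"
  shows "uniform_measure lborel {a..b} = density lborel (\<lambda>x. ennreal (indicator {a..b} x / (b - a)))"
  unfolding uniform_measure_def
proof (rule density_cong)
  show "AE x in lborel. indicator {a..b} x / emeasure lborel {a..b} = ennreal (indicator {a..b} x / (b - a))"
    using assms by (auto simp: divide_ennreal[symmetric] indicator_def)
qed auto

lemma integral_uniform_measure_Icc:
  fixes f :: "real \<Rightarrow> real"
  assumes "a < b" and f: "f \<in> borel_measurable borel"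
  shows "integral\<^sup>L (uniform_measure lborel {a..b}) f = (LBINT x:{a..b}. f x) / (b - a)"
proof -
  have "integral\<^sup>L (uniform_measure lborel {a..b}) f = (LBINT x. (indicator {a..b} x / (b - a)) *\<^sub>R f x)"
    unfolding density_uniform_measure_Icc[OF assms(1)]
    by (rule integral_density) (use assms in auto)
  also have "\<dots> = (LBINT x. (indicator {a..b} x *\<^sub>R f x) / (b - a))"
    by simp
  finally show ?thesis
    unfolding set_lebesgue_integral_def by (simp only: Bochner_Integration.integral_divide_zero)
qed

lemma integrable_uniform_measure_Icc_iff:
  fixes f :: "real \<Rightarrow> real"
  assumes "a < b" and f: "f \<in> borel_measurable borel"
  shows "integrable (uniform_measure lborel {a..b}) f \<longleftrightarrow> set_integrable lborel {a..b} f"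
proof -
  have "integrable (uniform_measure lborel {a..b}) f \<longleftrightarrow> integrable lborel (\<lambda>x. (indicator {a..b} x / (b - a)) *\<^sub>R f x)"
    unfolding density_uniform_measure_Icc[OF assms(1)]
    by (rule integrable_density) (use assms in auto)
  also have "\<dots> \<longleftrightarrow> integrable lborel (\<lambda>x. (indicator {a..b} x *\<^sub>R f x) / (b - a))"
    by simp
  also have "\<dots> \<longleftrightarrow> integrable lborel (\<lambda>x. indicator {a..b} x *\<^sub>R f x)"
    using assms by (simp add: divide_inverse del: times_divide_eq_left)
  finally show ?thesis unfolding set_integrable_def .
qed

lemma uniform_measure_Icc_laws:
  fixes a b :: real
  assumes "a < b"
  shows "prob_space (uniform_measure lborel {a..b})" "sets (uniform_measure lborel {a..b}) = sets borel"
  using assms by (auto intro: prob_space_uniform_measure)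

lemma partition_mono:
  fixes t :: "nat \<Rightarrow> real"
  assumes "\<And>i. i < N \<Longrightarrow> t i < t (Suc i)" "i \<le> j" "j \<le> N"
  shows "t i \<le> t j"
  using assms(2,3)
proof (induction j rule: dec_induct)
  case (step j)
  then show ?case using assms(1)[of j] by auto
qed simp

text \<open>The closed cells share endpoints. Additivity is proved for the gauge integral, where
  adjacent closed intervals combine directly, and transferred to the Lebesgue integral.\<close>

lemma set_integral_partition:
  fixes f :: "real \<Rightarrow> real" and t :: "nat \<Rightarrow> real"
  assumes t: "\<And>i. i < N \<Longrightarrow> t i < t (Suc i)" and f: "set_integrable lborel {t 0..t N} f"
  shows "(LBINT x:{t 0..t N}. f x) = (\<Sum>i<N. LBINT x:{t i..t (Suc i)}. f x)"
proof -
  have sub: "set_integrable lborel {t i..t j} f" if "i \<le> j" "j \<le> N" for i j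
    using partition_mono[of N t, OF t, of 0 i] partition_mono[of N t, OF t, of j N] that
    by (intro set_integrable_subset[OF f]) auto
  have "integral {t 0..t n} f = (\<Sum>i<n. integral {t i..t (Suc i)} f)" if "n \<le> N" for n
    using that
  proof (induction n)
    case (Suc n)
    have "integral {t 0..t n} f + integral {t n..t (Suc n)} f = integral {t 0..t (Suc n)} f"
      using Suc.prems partition_mono[of N t, OF t, of 0 n] t[of n] sub[of 0 "Suc n"]
      by (intro Henstock_Kurzweil_Integration.integral_combine set_borel_integral_eq_integral(1)) auto
    then show ?case using Suc by simp
  qed simp
  moreover have "(LBINT x:{t i..t j}. f x) = integral {t i..t j} f" if "i \<le> j" "j \<le> N" for i j
    using sub[OF that] by (rule set_borel_integral_eq_integral(2))
  ultimately show ?thesis by simp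
qed

section \<open>Sampling the field at independent random points\<close>

context square_integrable_field
begin

text \<open>By the product law the second moment at the random point is an average of second moments
  at fixed points, all at most \<open>B\<close>.\<close>

lemma sampled_field_square_integrable:
  assumes \<eta>[measurable]: "\<eta> \<in> borel_measurable M"
    and law: "distr M F (\<lambda>\<omega>. \<omega>) \<Otimes>\<^sub>M distr M borel \<eta> = distr M (F \<Otimes>\<^sub>M borel) (\<lambda>\<omega>. (\<omega>, \<eta> \<omega>))"
  shows "integrable M (\<lambda>\<omega>. (X (\<eta> \<omega>) \<omega>)\<^sup>2)"
proof (rule integrableI_bounded)
  interpret U: prob_space "distr M borel \<eta>" by (rule prob_space_distr) measurable
  note [measurable] = X_measurable_comp
  show "(\<lambda>\<omega>. (X (\<eta> \<omega>) \<omega>)\<^sup>2) \<in> borel_measurable M" by measurable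
  have meas: "(\<lambda>z. ennreal ((X (snd z) (fst z))\<^sup>2)) \<in> borel_measurable (F \<Otimes>\<^sub>M borel)"
    using X_measurable_comp_F by measurable
  have "(\<integral>\<^sup>+\<omega>. ennreal ((X (\<eta> \<omega>) \<omega>)\<^sup>2) \<partial>M) = (\<integral>\<^sup>+y. (\<integral>\<^sup>+\<omega>. ennreal ((X y \<omega>)\<^sup>2) \<partial>M) \<partial>distr M borel \<eta>)"
    using nn_integral_product_law[OF ident_measurable_F \<eta> law meas] by simp
  also have "\<dots> \<le> (\<integral>\<^sup>+y. ennreal B \<partial>distr M borel \<eta>)"
    by (intro nn_integral_mono nn_second_moment_le)
  also have "\<dots> < \<infinity>" by (simp add: U.emeasure_space_1[simplified])
  finally show "(\<integral>\<^sup>+\<omega>. ennreal (norm ((X (\<eta> \<omega>) \<omega>)\<^sup>2)) \<partial>M) < \<infinity>" by simp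
qed

lemma sample_deviation_square_integrable:
  assumes \<eta>[measurable]: "\<eta> \<in> borel_measurable M"
    and law: "distr M F (\<lambda>\<omega>. \<omega>) \<Otimes>\<^sub>M distr M borel \<eta> = distr M (F \<Otimes>\<^sub>M borel) (\<lambda>\<omega>. (\<omega>, \<eta> \<omega>))"
    and U: "prob_space U" "sets U = sets borel"
  shows "integrable M (\<lambda>\<omega>. (path_mean U \<omega> - X (\<eta> \<omega>) \<omega>)\<^sup>2)"
    and "(\<lambda>\<omega>. path_mean U \<omega> - X (\<eta> \<omega>) \<omega>) \<in> borel_measurable M"
proof -
  note [measurable] = X_measurable_comp
  have [measurable]: "path_mean U \<in> borel_measurable M"
    by (rule measurable_compose[OF ident_measurable_F path_mean_measurable[OF U]])
  show "(\<lambda>\<omega>. path_mean U \<omega> - X (\<eta> \<omega>) \<omega>) \<in> borel_measurable M" by measurable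
  have "integrable M (\<lambda>\<omega>. path_mean U \<omega> * X (\<eta> \<omega>) \<omega>)"
    by (rule integrable_mult_if_square_integrable)
      (use path_mean_square_integrable[OF U] sampled_field_square_integrable[OF \<eta> law] in measurable)
  then show "integrable M (\<lambda>\<omega>. (path_mean U \<omega> - X (\<eta> \<omega>) \<omega>)\<^sup>2)"
    unfolding power2_diff mult.assoc
    using path_mean_square_integrable[OF U] sampled_field_square_integrable[OF \<eta> law]
    by (intro Bochner_Integration.integrable_add Bochner_Integration.integrable_diff integrable_mult_right) auto
qed

text \<open>Conditioning on \<open>F\<close> replaces the random point by an integral over its law
  \<open>U\<close>; what remains is the mean variance of the path.\<close>

lemma sample_deviation_second_moment:
  assumes \<eta>[measurable]: "\<eta> \<in> borel_measurable M"
    and law: "distr M F (\<lambda>\<omega>. \<omega>) \<Otimes>\<^sub>M distr M borel \<eta> = distr M (F \<Otimes>\<^sub>M borel) (\<lambda>\<omega>. (\<omega>, \<eta> \<omega>))"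
    and U: "distr M borel \<eta> = U"
  shows "expectation (\<lambda>\<omega>. (path_mean U \<omega> - X (\<eta> \<omega>) \<omega>)\<^sup>2)
     = (\<integral>z. (\<integral>\<omega>. (X (fst z) \<omega> - X (snd z) \<omega>)\<^sup>2 \<partial>M) \<partial>(U \<Otimes>\<^sub>M U)) / 2"
proof -
  have U': "prob_space U" "sets U = sets borel"
    unfolding U[symmetric] by (auto intro: prob_space_distr)
  note [measurable] = X_measurable_comp_F path_mean_measurable[OF U']
  have meas: "(\<lambda>z. (path_mean U (fst z) - X (snd z) (fst z))\<^sup>2) \<in> borel_measurable (F \<Otimes>\<^sub>M borel)"
    by measurable
  have "expectation (\<lambda>\<omega>. (path_mean U \<omega> - X (\<eta> \<omega>) \<omega>)\<^sup>2) = (\<integral>\<omega>. (\<integral>y. (path_mean U \<omega> - X y \<omega>)\<^sup>2 \<partial>U) \<partial>M)"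
    using integral_product_law(1)[OF ident_measurable_F \<eta> law meas]
      sample_deviation_square_integrable(1)[OF \<eta> law U'] unfolding U by simp
  also have "\<dots> = (\<integral>z. (\<integral>\<omega>. (X (fst z) \<omega> - X (snd z) \<omega>)\<^sup>2 \<partial>M) \<partial>(U \<Otimes>\<^sub>M U)) / 2"
    by (rule mean_path_variance(1)[OF U'])
  finally show ?thesis .
qed

text \<open>Conditionally on \<open>F\<close> the two factors are independent and centred.\<close>

lemma sample_deviations_orthogonal:
  assumes \<eta>[measurable]: "\<eta> \<in> borel_measurable M" and \<zeta>[measurable]: "\<zeta> \<in> borel_measurable M"
    and law1: "distr M F (\<lambda>\<omega>. \<omega>) \<Otimes>\<^sub>M distr M borel \<eta> = distr M (F \<Otimes>\<^sub>M borel) (\<lambda>\<omega>. (\<omega>, \<eta> \<omega>))"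
    and law2: "distr M F (\<lambda>\<omega>. \<omega>) \<Otimes>\<^sub>M distr M borel \<zeta> = distr M (F \<Otimes>\<^sub>M borel) (\<lambda>\<omega>. (\<omega>, \<zeta> \<omega>))"
    and law: "distr M F (\<lambda>\<omega>. \<omega>) \<Otimes>\<^sub>M distr M (borel \<Otimes>\<^sub>M borel) (\<lambda>\<omega>. (\<eta> \<omega>, \<zeta> \<omega>))
       = distr M (F \<Otimes>\<^sub>M (borel \<Otimes>\<^sub>M borel)) (\<lambda>\<omega>. (\<omega>, (\<eta> \<omega>, \<zeta> \<omega>)))"
    and U: "distr M borel \<eta> = U" and V: "distr M borel \<zeta> = V"
    and UV: "distr M (borel \<Otimes>\<^sub>M borel) (\<lambda>\<omega>. (\<eta> \<omega>, \<zeta> \<omega>)) = U \<Otimes>\<^sub>M V"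
  shows "expectation (\<lambda>\<omega>. (path_mean U \<omega> - X (\<eta> \<omega>) \<omega>) * (path_mean V \<omega> - X (\<zeta> \<omega>) \<omega>)) = 0"
proof -
  have U': "prob_space U" "sets U = sets borel" and V': "prob_space V" "sets V = sets borel"
    unfolding U[symmetric] V[symmetric] by (auto intro: prob_space_distr)
  interpret U: prob_space U by fact
  interpret V: prob_space V by fact
  interpret UV: pair_prob_space U V ..
  note [measurable] = X_measurable_comp_F path_mean_measurable[OF U'] path_mean_measurable[OF V']
  let ?g = "\<lambda>z. (path_mean U (fst z) - X (fst (snd z)) (fst z)) * (path_mean V (fst z) - X (snd (snd z)) (fst z))"
  have meas: "?g \<in> borel_measurable (F \<Otimes>\<^sub>M (borel \<Otimes>\<^sub>M borel))"
    by measurable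
  have pair: "(\<lambda>\<omega>. (\<eta> \<omega>, \<zeta> \<omega>)) \<in> measurable M (borel \<Otimes>\<^sub>M borel)" by measurable
  have int: "integrable M (\<lambda>\<omega>. ?g (\<omega>, (\<eta> \<omega>, \<zeta> \<omega>)))"
    using sample_deviation_square_integrable[OF \<eta> law1 U'] sample_deviation_square_integrable[OF \<zeta> law2 V']
    by (simp add: integrable_mult_if_square_integrable)
  note key = integral_product_law[OF ident_measurable_F pair law meas int, unfolded UV]
  have "expectation (\<lambda>\<omega>. (path_mean U \<omega> - X (\<eta> \<omega>) \<omega>) * (path_mean V \<omega> - X (\<zeta> \<omega>) \<omega>))
    = (\<integral>\<omega>. (\<integral>y. ?g (\<omega>, y) \<partial>(U \<Otimes>\<^sub>M V)) \<partial>M)"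
    using key(1) by simp
  also have "\<dots> = 0"
  proof (rule integral_eq_zero_AE)
    show "AE \<omega> in M. (\<integral>y. ?g (\<omega>, y) \<partial>(U \<Otimes>\<^sub>M V)) = 0"
      using key(2) AE_path_square_integrable(3)[OF V']
    proof eventually_elim
      case (elim \<omega>)
      have "(\<integral>y. ?g (\<omega>, y) \<partial>(U \<Otimes>\<^sub>M V)) = (\<integral>s. \<integral>t. (path_mean U \<omega> - X s \<omega>) * (path_mean V \<omega> - X t \<omega>) \<partial>V \<partial>U)"
        using UV.integral_fst'[OF elim(1)] by simp
      \<comment> \<open>The inner integral is already zero: the first factor is constant in
        \<open>t\<close>, and the second is centred under \<open>V\<close>.\<close>
      also have "\<dots> = 0"
        using elim(2) by (simp add: path_mean_def V.prob_space)
      finally show ?case .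
    qed
  qed
  finally show ?thesis .
qed

text \<open>This cuts the integral along the cells of the quadrature, so that the error becomes a
  sum of one centred deviation per cell.\<close>

lemma AE_integral_eq_sum_path_mean:
  fixes t :: "nat \<Rightarrow> real"
  assumes t: "\<And>i. i < N \<Longrightarrow> t i < t (Suc i)" and "0 < N"
  shows "AE \<omega> in M. (LBINT x:{t 0..t N}. X x \<omega>)
     = (\<Sum>i<N. (t (Suc i) - t i) * path_mean (uniform_measure lborel {t i..t (Suc i)}) \<omega>)"
proof -
  note [measurable] = X_measurable_comp
  have lt: "t 0 < t N"
    using t[of 0] partition_mono[of N t, OF t, of 1 N] \<open>0 < N\<close> by simp
  show ?thesis
    using AE_path_square_integrable(3)[OF uniform_measure_Icc_laws[OF lt]] AE_space
  proof eventually_elim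
    case (elim \<omega>)
    have [measurable]: "(\<lambda>x. X x \<omega>) \<in> borel_measurable borel"
      using elim(2) by measurable
    have "set_integrable lborel {t 0..t N} (\<lambda>x. X x \<omega>)"
      using elim(1) lt by (simp add: integrable_uniform_measure_Icc_iff)
    then have "(LBINT x:{t 0..t N}. X x \<omega>) = (\<Sum>i<N. LBINT x:{t i..t (Suc i)}. X x \<omega>)"
      by (intro set_integral_partition t)
    also have "\<dots> = (\<Sum>i<N. (t (Suc i) - t i) * path_mean (uniform_measure lborel {t i..t (Suc i)}) \<omega>)"
    proof (rule sum.cong)
      fix i assume "i \<in> {..<N}"
      then have "t i < t (Suc i)" using t by simp
      then show "(LBINT x:{t i..t (Suc i)}. X x \<omega>) = (t (Suc i) - t i) * path_mean (uniform_measure lborel {t i..t (Suc i)}) \<omega>"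
        unfolding path_mean_def by (subst integral_uniform_measure_Icc) auto
    qed simp
    finally show ?case .
  qed
qed

text \<open>An exact formula for every strictly increasing partition, before any asymptotics. The
  squared sum of deviations is a double sum, whose off-diagonal terms vanish by
  \<open>sample_deviations_orthogonal\<close>; the diagonal ones are given by
  \<open>sample_deviation_second_moment\<close>.\<close>

lemma stratified_mean_square_error:
  fixes t :: "nat \<Rightarrow> real" and \<eta> :: "nat \<Rightarrow> 'a \<Rightarrow> real"
  defines "U \<equiv> \<lambda>i. uniform_measure lborel {t i..t (Suc i)}"
  assumes t: "\<And>i. i < N \<Longrightarrow> t i < t (Suc i)" and "0 < N"
    and \<eta>: "\<And>i. i < N \<Longrightarrow> \<eta> i \<in> borel_measurable M"
    and distr: "\<And>i. i < N \<Longrightarrow> distr M lborel (\<eta> i) = U i"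
    and ind: "indep_vars (\<lambda>_. borel) \<eta> {..<N}"
    and indF: "indep_set (sets F)
          (sets (vimage_algebra (space M) (\<lambda>\<omega>. \<lambda>i\<in>{..<N}. \<eta> i \<omega>) (Pi\<^sub>M {..<N} (\<lambda>_. borel))))"
  shows "expectation (\<lambda>\<omega>. ((LBINT x:{t 0..t N}. X x \<omega>) - (\<Sum>i<N. X (\<eta> i \<omega>) \<omega> * (t (Suc i) - t i)))\<^sup>2)
     = (\<Sum>i<N. (t (Suc i) - t i)\<^sup>2 * (\<integral>z. (\<integral>\<omega>. (X (fst z) \<omega> - X (snd z) \<omega>)\<^sup>2 \<partial>M) \<partial>(U i \<Otimes>\<^sub>M U i)) / 2)"
proof -
  \<comment> \<open>\<open>indF\<close> speaks about the vector of all points. The joint laws of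
    \<open>F\<close> with one or two points therefore both come from \<open>law\<close> below, with
    coordinate projections for \<open>g\<close>.\<close>
  define H where "H = (\<lambda>\<omega>. \<lambda>i\<in>{..<N}. \<eta> i \<omega>)"
  define Z where "Z i \<omega> = path_mean (U i) \<omega> - X (\<eta> i \<omega>) \<omega>" for i \<omega>
  have H: "H \<in> space M \<rightarrow> space (Pi\<^sub>M {..<N} (\<lambda>_. borel))"
    unfolding H_def by (auto simp: space_PiM)
  have id: "(\<lambda>\<omega>. \<omega>) -` P \<inter> space M \<in> sets F" if "P \<in> sets F" for P
    using that subalg sets.sets_into_space[OF that] by (auto simp: subalgebra_def Int_absorb2)
  have U': "prob_space (U i)" "sets (U i) = sets borel" if "i < N" for i
    unfolding U_def using uniform_measure_Icc_laws[OF t[OF that]] by auto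
  \<comment> \<open>A law depends on its target only through the measurable space, so
    \<open>lborel\<close> may be traded for \<open>borel\<close>.\<close>
  have d: "distr M borel (\<eta> i) = U i" if "i < N" for i
    using distr[OF that] distr_cong[of M M borel lborel "\<eta> i" "\<eta> i"] by simp
  have law: "distr M F (\<lambda>\<omega>. \<omega>) \<Otimes>\<^sub>M distr M T (\<lambda>\<omega>. g (H \<omega>)) = distr M (F \<Otimes>\<^sub>M T) (\<lambda>\<omega>. (\<omega>, g (H \<omega>)))"
    if g: "g \<in> measurable (Pi\<^sub>M {..<N} (\<lambda>_. borel)) T" for g :: "(nat \<Rightarrow> real) \<Rightarrow> 'b" and T
  proof (rule indep_set_product_law[OF ident_measurable_F _ indF id])
    have "H \<in> measurable M (Pi\<^sub>M {..<N} (\<lambda>_. borel))"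
      unfolding H_def using \<eta> by (intro measurable_restrict) auto
    from measurable_compose[OF this g] show "(\<lambda>\<omega>. g (H \<omega>)) \<in> measurable M T" .
    fix Q assume Q: "Q \<in> sets T"
    have "(\<lambda>\<omega>. g (H \<omega>)) -` Q \<inter> space M = H -` (g -` Q \<inter> space (Pi\<^sub>M {..<N} (\<lambda>_. borel))) \<inter> space M"
      using H by auto
    then show "(\<lambda>\<omega>. g (H \<omega>)) -` Q \<inter> space M
        \<in> sets (vimage_algebra (space M) (\<lambda>\<omega>. \<lambda>i\<in>{..<N}. \<eta> i \<omega>) (Pi\<^sub>M {..<N} (\<lambda>_. borel)))"
      using in_vimage_algebra[OF measurable_sets[OF g Q], of H "space M"] unfolding H_def by simp
  qed
  have law1: "distr M F (\<lambda>\<omega>. \<omega>) \<Otimes>\<^sub>M distr M borel (\<eta> i) = distr M (F \<Otimes>\<^sub>M borel) (\<lambda>\<omega>. (\<omega>, \<eta> i \<omega>))"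
    if "i < N" for i
    using law[of "\<lambda>f. f i" borel] that by (simp add: H_def)
  have law2: "distr M F (\<lambda>\<omega>. \<omega>) \<Otimes>\<^sub>M distr M (borel \<Otimes>\<^sub>M borel) (\<lambda>\<omega>. (\<eta> i \<omega>, \<eta> j \<omega>))
       = distr M (F \<Otimes>\<^sub>M (borel \<Otimes>\<^sub>M borel)) (\<lambda>\<omega>. (\<omega>, (\<eta> i \<omega>, \<eta> j \<omega>)))"
    if "i < N" "j < N" for i j
    using law[of "\<lambda>f. (f i, f j)" "borel \<Otimes>\<^sub>M borel"] that by (simp add: H_def)
  have UU: "distr M (borel \<Otimes>\<^sub>M borel) (\<lambda>\<omega>. (\<eta> i \<omega>, \<eta> j \<omega>)) = U i \<Otimes>\<^sub>M U j"
    if "i < N" "j < N" "i \<noteq> j" for i j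
  proof -
    have "indep_var borel (\<eta> i) borel (\<eta> j)"
      using indep_var_compose[OF indep_var_restrict[OF ind, of "{i}" "{j}"], of "\<lambda>f. f i" borel "\<lambda>f. f j" borel] that
      by (simp add: o_def)
    then show ?thesis
      unfolding indep_var_distribution_eq using that d by simp
  qed
  have Zint: "integrable M (\<lambda>\<omega>. (Z i \<omega>)\<^sup>2)" and Zmeas: "Z i \<in> borel_measurable M" if "i < N" for i
    using sample_deviation_square_integrable[OF \<eta> law1 U'] that unfolding Z_def by auto
  have ZZ: "integrable M (\<lambda>\<omega>. Z i \<omega> * Z j \<omega>)" if "i < N" "j < N" for i j
    by (rule integrable_mult_if_square_integrable) (use Zint Zmeas that in auto)
  have orth: "expectation (\<lambda>\<omega>. Z i \<omega> * Z j \<omega>) = 0" if "i < N" "j < N" "i \<noteq> j" for i j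
    unfolding Z_def using that by (intro sample_deviations_orthogonal \<eta> law1 law2 d UU)
  let ?D = "\<lambda>i. t (Suc i) - t i"
  have int_eq: "AE \<omega> in M. (LBINT x:{t 0..t N}. X x \<omega>) = (\<Sum>i<N. ?D i * path_mean (U i) \<omega>)"
    unfolding U_def by (intro AE_integral_eq_sum_path_mean t \<open>0 < N\<close>)
  have "AE \<omega> in M. (LBINT x:{t 0..t N}. X x \<omega>) - (\<Sum>i<N. X (\<eta> i \<omega>) \<omega> * ?D i) = (\<Sum>i<N. ?D i * Z i \<omega>)"
    using int_eq
    by eventually_elim (simp add: Z_def U_def algebra_simps sum_subtractf[symmetric])
  then have ae: "AE \<omega> in M. ((LBINT x:{t 0..t N}. X x \<omega>) - (\<Sum>i<N. X (\<eta> i \<omega>) \<omega> * ?D i))\<^sup>2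
     = (\<Sum>i<N. \<Sum>j<N. ?D i * ?D j * (Z i \<omega> * Z j \<omega>))"
    by eventually_elim (simp add: power2_eq_square sum_product mult_ac)
  have "expectation (\<lambda>\<omega>. ((LBINT x:{t 0..t N}. X x \<omega>) - (\<Sum>i<N. X (\<eta> i \<omega>) \<omega> * ?D i))\<^sup>2)
     = expectation (\<lambda>\<omega>. \<Sum>i<N. \<Sum>j<N. ?D i * ?D j * (Z i \<omega> * Z j \<omega>))"
  proof (rule integral_cong_AE[OF _ _ ae])
    note [measurable] = X_measurable_comp
    have [measurable]: "\<And>i. i \<in> {..<N} \<Longrightarrow> \<eta> i \<in> borel_measurable M" "\<And>i. i \<in> {..<N} \<Longrightarrow> Z i \<in> borel_measurable M"
      using \<eta> Zmeas by auto
    show "(\<lambda>\<omega>. \<Sum>i<N. \<Sum>j<N. ?D i * ?D j * (Z i \<omega> * Z j \<omega>)) \<in> borel_measurable M"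
      by measurable
    have [measurable]: "(\<lambda>\<omega>. LBINT x:{t 0..t N}. X x \<omega>) \<in> borel_measurable M"
      unfolding set_lebesgue_integral_def by measurable
    show "(\<lambda>\<omega>. ((LBINT x:{t 0..t N}. X x \<omega>) - (\<Sum>i<N. X (\<eta> i \<omega>) \<omega> * ?D i))\<^sup>2) \<in> borel_measurable M"
      by measurable
  qed
  also have "\<dots> = (\<Sum>i<N. \<Sum>j<N. ?D i * ?D j * expectation (\<lambda>\<omega>. Z i \<omega> * Z j \<omega>))"
  proof -
    have "expectation (\<lambda>\<omega>. \<Sum>i<N. \<Sum>j<N. ?D i * ?D j * (Z i \<omega> * Z j \<omega>))
      = (\<Sum>i<N. expectation (\<lambda>\<omega>. \<Sum>j<N. ?D i * ?D j * (Z i \<omega> * Z j \<omega>)))"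
      by (rule Bochner_Integration.integral_sum) (auto intro!: Bochner_Integration.integrable_sum ZZ)
    also have "\<dots> = (\<Sum>i<N. \<Sum>j<N. expectation (\<lambda>\<omega>. ?D i * ?D j * (Z i \<omega> * Z j \<omega>)))"
      by (intro sum.cong refl Bochner_Integration.integral_sum) (auto intro!: ZZ)
    finally show ?thesis by simp
  qed
  also have "\<dots> = (\<Sum>i<N. \<Sum>j<N. if j = i then (?D i)\<^sup>2 * expectation (\<lambda>\<omega>. (Z i \<omega>)\<^sup>2) else 0)"
    by (intro sum.cong refl) (auto simp: orth power2_eq_square)
  also have "\<dots> = (\<Sum>i<N. (?D i)\<^sup>2 * expectation (\<lambda>\<omega>. (Z i \<omega>)\<^sup>2))"
    by simp
  also have "\<dots> = (\<Sum>i<N. (?D i)\<^sup>2 * (\<integral>z. (\<integral>\<omega>. (X (fst z) \<omega> - X (snd z) \<omega>)\<^sup>2 \<partial>M) \<partial>(U i \<Otimes>\<^sub>M U i)) / 2)"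
    unfolding Z_def by (intro sum.cong refl) (simp add: sample_deviation_second_moment[OF \<eta> law1 d])
  finally show ?thesis .
qed

end

section \<open>The error on a single cell\<close>

lemma set_lborel_integral_eq_integral:
  fixes f :: "real \<Rightarrow> real"
  assumes "continuous_on {a..b} f"
  shows "(LBINT x:{a..b}. f x) = integral {a..b} f"
  by (rule set_borel_integral_eq_integral(2)[OF borel_integrable_atLeastAtMost'[OF assms]])

lemma set_lborel_integral_eq_if_has_integral:
  fixes f :: "real \<Rightarrow> real"
  assumes "(f has_integral y) {a..b}" "continuous_on {a..b} f"
  shows "(LBINT x:{a..b}. f x) = y"
  unfolding set_lborel_integral_eq_integral[OF assms(2)] using assms(1) by (rule integral_unique)

text \<open>The base may vanish, as \<open>\<bar>s - t\<bar>\<close> does on the diagonal; a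
  positive exponent keeps the power continuous there.\<close>

lemma continuous_on_powr_nonneg:
  fixes f :: "real \<Rightarrow> real"
  assumes "continuous_on S f" "\<And>x. x \<in> S \<Longrightarrow> 0 \<le> f x" "0 < p"
  shows "continuous_on S (\<lambda>x. f x powr p)"
  using assms by (intro continuous_on_powr') auto

lemma has_integral_powr_left:
  fixes a b p :: real
  assumes "a \<le> b" "0 < p"
  shows "((\<lambda>x. (x - a) powr p) has_integral (b - a) powr (p + 1) / (p + 1)) {a..b}"
proof -
  have "((\<lambda>x. (x - a) powr p) has_integral (b - a) powr (p + 1) / (p + 1) - (a - a) powr (p + 1) / (p + 1)) {a..b}"
  \<comment> \<open>The interior version asks for no derivative at \<open>x = a\<close>, where the
    base of the power is zero.\<close>
  proof (rule fundamental_theorem_of_calculus_interior)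
    show "continuous_on {a..b} (\<lambda>x. (x - a) powr (p + 1) / (p + 1))"
      using assms by (intro continuous_intros continuous_on_powr_nonneg) auto
    fix x assume "x \<in> {a<..<b}"
    then show "((\<lambda>x. (x - a) powr (p + 1) / (p + 1)) has_vector_derivative (x - a) powr p) (at x)"
      using assms by (auto intro!: derivative_eq_intros simp: has_real_derivative_iff_has_vector_derivative[symmetric])
  qed (use assms in auto)
  then show ?thesis using assms by simp
qed

lemma has_integral_powr_right:
  fixes a b p :: real
  assumes "a \<le> b" "0 < p"
  shows "((\<lambda>x. (b - x) powr p) has_integral (b - a) powr (p + 1) / (p + 1)) {a..b}"
proof -
  have "((\<lambda>x. (b - x) powr p) has_integral - ((b - b) powr (p + 1) / (p + 1)) - - ((b - a) powr (p + 1) / (p + 1))) {a..b}"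
  proof (rule fundamental_theorem_of_calculus_interior)
    show "continuous_on {a..b} (\<lambda>x. - ((b - x) powr (p + 1) / (p + 1)))"
      using assms by (intro continuous_intros continuous_on_powr_nonneg) auto
    fix x assume "x \<in> {a<..<b}"
    then show "((\<lambda>x. - ((b - x) powr (p + 1) / (p + 1))) has_vector_derivative (b - x) powr p) (at x)"
      using assms by (auto intro!: derivative_eq_intros simp: has_real_derivative_iff_has_vector_derivative[symmetric])
  qed (use assms in auto)
  then show ?thesis using assms by simp
qed

lemma integral_abs_diff_powr:
  fixes a b s p :: real
  assumes "a \<le> s" "s \<le> b" "0 < p"
  shows "(LBINT t:{a..b}. \<bar>s - t\<bar> powr p) = ((s - a) powr (p + 1) + (b - s) powr (p + 1)) / (p + 1)"
proof (rule set_lborel_integral_eq_if_has_integral)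
  have "((\<lambda>t. \<bar>s - t\<bar> powr p) has_integral (s - a) powr (p + 1) / (p + 1)) {a..s}"
    by (rule has_integral_eq[OF _ has_integral_powr_right]) (use assms in auto)
  moreover have "((\<lambda>t. \<bar>s - t\<bar> powr p) has_integral (b - s) powr (p + 1) / (p + 1)) {s..b}"
    by (rule has_integral_eq[OF _ has_integral_powr_left]) (use assms in auto)
  ultimately show "((\<lambda>t. \<bar>s - t\<bar> powr p) has_integral ((s - a) powr (p + 1) + (b - s) powr (p + 1)) / (p + 1)) {a..b}"
    unfolding add_divide_distrib by (rule has_integral_combine[OF assms(1,2)])
  show "continuous_on {a..b} (\<lambda>t. \<bar>s - t\<bar> powr p)"
    using assms by (intro continuous_on_powr_nonneg continuous_intros) auto
qed

text \<open>The source of \<open>a_const\<close>: for \<open>p = \<alpha>\<close>, multiplying the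
  double integral by half the squared length of the cell gives
  \<open>a_const \<alpha> * (b - a) powr (2 + \<alpha>)\<close>. The inner integral splits at
  \<open>s\<close> into two powers, and these contribute equally to the outer one.\<close>

lemma integral_uniform_abs_diff_powr:
  fixes a b p :: real
  assumes ab: "a < b" and p: "0 < p"
  defines "U \<equiv> uniform_measure lborel {a..b}"
  shows "integrable (U \<Otimes>\<^sub>M U) (\<lambda>z. \<bar>fst z - snd z\<bar> powr p)"
    and "(\<integral>z. \<bar>fst z - snd z\<bar> powr p \<partial>(U \<Otimes>\<^sub>M U)) = 2 * (b - a) powr p / ((1 + p) * (2 + p))"
    and "AE z in U \<Otimes>\<^sub>M U. fst z \<in> {a..b} \<and> snd z \<in> {a..b}"
proof -
  interpret U: prob_space U unfolding U_def by (rule uniform_measure_Icc_laws(1)[OF ab])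
  interpret UU: pair_prob_space U U ..
  have sets[measurable_cong]: "sets U = sets borel" by (simp add: U_def)
  have in_U: "AE x in U. x \<in> {a..b}"
    unfolding U_def by (rule AE_uniform_measureI) auto
  show in_UU: "AE z in U \<Otimes>\<^sub>M U. fst z \<in> {a..b} \<and> snd z \<in> {a..b}"
  proof (rule UU.AE_pair_measure)
    show "{z \<in> space (U \<Otimes>\<^sub>M U). fst z \<in> {a..b} \<and> snd z \<in> {a..b}} \<in> sets (U \<Otimes>\<^sub>M U)"
      by measurable
    show "AE x in U. AE y in U. fst (x, y) \<in> {a..b} \<and> snd (x, y) \<in> {a..b}"
      using in_U
    proof eventually_elim
      case (elim x)
      show ?case using in_U by eventually_elim (use elim in simp)
    qed
  qed
  show int: "integrable (U \<Otimes>\<^sub>M U) (\<lambda>z. \<bar>fst z - snd z\<bar> powr p)"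
  proof (rule UU.integrable_const_bound[where B = "(b - a) powr p"])
    show "AE z in U \<Otimes>\<^sub>M U. norm (\<bar>fst z - snd z\<bar> powr p) \<le> (b - a) powr p"
      using in_UU by eventually_elim (use p in \<open>auto intro!: powr_mono2\<close>)
  qed measurable
  have "(\<integral>z. \<bar>fst z - snd z\<bar> powr p \<partial>(U \<Otimes>\<^sub>M U)) = (\<integral>s. (\<integral>t. \<bar>s - t\<bar> powr p \<partial>U) \<partial>U)"
    using UU.integral_fst'[OF int] by simp
  also have "\<dots> = (\<integral>s. ((s - a) powr (p + 1) + (b - s) powr (p + 1)) / (p + 1) / (b - a) \<partial>U)"
  proof (rule integral_cong_AE)
    show "AE s in U. (\<integral>t. \<bar>s - t\<bar> powr p \<partial>U) = ((s - a) powr (p + 1) + (b - s) powr (p + 1)) / (p + 1) / (b - a)"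
      using in_U
    proof eventually_elim
      case (elim s)
      have "(\<integral>t. \<bar>s - t\<bar> powr p \<partial>U) = (LBINT t:{a..b}. \<bar>s - t\<bar> powr p) / (b - a)"
        unfolding U_def using ab by (intro integral_uniform_measure_Icc) auto
      then show ?case
        using integral_abs_diff_powr[of a s b p] elim p by simp
    qed
  qed measurable
  also have "\<dots> = (LBINT s:{a..b}. ((s - a) powr (p + 1) + (b - s) powr (p + 1)) / (p + 1) / (b - a)) / (b - a)"
    unfolding U_def using ab by (intro integral_uniform_measure_Icc) auto
  also have "(LBINT s:{a..b}. ((s - a) powr (p + 1) + (b - s) powr (p + 1)) / (p + 1) / (b - a))
      = ((b - a) powr (p + 1 + 1) / (p + 1 + 1) + (b - a) powr (p + 1 + 1) / (p + 1 + 1)) / (p + 1) / (b - a)"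
    using ab p
    by (intro set_lborel_integral_eq_if_has_integral has_integral_divide has_integral_add
          has_integral_powr_left has_integral_powr_right continuous_intros continuous_on_powr_nonneg) auto
  also have "(b - a) powr (p + 1 + 1) = (b - a) powr p * (b - a) * (b - a)"
    using ab by (simp add: powr_add power2_eq_square)
  finally show "(\<integral>z. \<bar>fst z - snd z\<bar> powr p \<partial>(U \<Otimes>\<^sub>M U)) = 2 * (b - a) powr p / ((1 + p) * (2 + p))"
    using ab p by (simp add: divide_simps) (simp add: algebra_simps)
qed

text \<open>Here \<open>K\<close> will be the second moment of an increment and \<open>k\<close> the
  value of \<open>c\<close> at the left endpoint. A pointwise comparison with the exact power kernel
  is integrated, so the error carries the same power of the cell length as the main term.\<close>

lemma cell_error_estimate:
  fixes K :: "real \<times> real \<Rightarrow> real" and a b \<alpha> k \<epsilon> :: real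
  assumes ab: "a < b" and \<alpha>: "0 < \<alpha>"
  defines "U \<equiv> uniform_measure lborel {a..b}"
  assumes K: "integrable (U \<Otimes>\<^sub>M U) K"
    and bound: "\<And>s t. s \<in> {a..b} \<Longrightarrow> t \<in> {a..b} \<Longrightarrow> \<bar>K (s, t) - k * \<bar>s - t\<bar> powr \<alpha>\<bar> \<le> \<epsilon> * \<bar>s - t\<bar> powr \<alpha>"
  shows "\<bar>(b - a)\<^sup>2 * integral\<^sup>L (U \<Otimes>\<^sub>M U) K / 2 - a_const \<alpha> * k * (b - a) powr (2 + \<alpha>)\<bar>
     \<le> \<epsilon> * a_const \<alpha> * (b - a) powr (2 + \<alpha>)"
proof -
  let ?f = "\<lambda>z :: real \<times> real. \<bar>fst z - snd z\<bar> powr \<alpha>"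
  let ?J = "2 * (b - a) powr \<alpha> / ((1 + \<alpha>) * (2 + \<alpha>))"
  note f = integral_uniform_abs_diff_powr[OF ab \<alpha>, folded U_def]
  have "integral\<^sup>L (U \<Otimes>\<^sub>M U) K - k * ?J = (\<integral>z. K z - k * ?f z \<partial>(U \<Otimes>\<^sub>M U))"
    using K f(1,2) by (subst Bochner_Integration.integral_diff) auto
  also have "\<bar>\<dots>\<bar> \<le> (\<integral>z. \<bar>K z - k * ?f z\<bar> \<partial>(U \<Otimes>\<^sub>M U))"
    by (rule integral_abs_bound)
  also have "\<dots> \<le> (\<integral>z. \<epsilon> * ?f z \<partial>(U \<Otimes>\<^sub>M U))"
  proof (rule integral_mono_AE)
    show "AE z in U \<Otimes>\<^sub>M U. \<bar>K z - k * ?f z\<bar> \<le> \<epsilon> * ?f z"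
      using f(3) by eventually_elim (use bound in auto)
  qed (use K f(1) in auto)
  finally have "\<bar>integral\<^sup>L (U \<Otimes>\<^sub>M U) K - k * ?J\<bar> \<le> \<epsilon> * ?J"
    using f(2) by simp
  then have le: "(b - a)\<^sup>2 / 2 * \<bar>integral\<^sup>L (U \<Otimes>\<^sub>M U) K - k * ?J\<bar> \<le> (b - a)\<^sup>2 / 2 * (\<epsilon> * ?J)"
    by (intro mult_left_mono) auto
  have J: "(b - a)\<^sup>2 / 2 * ?J = a_const \<alpha> * (b - a) powr (2 + \<alpha>)"
    using ab by (simp add: a_const_def powr_add)
  have "(b - a)\<^sup>2 * integral\<^sup>L (U \<Otimes>\<^sub>M U) K / 2 - a_const \<alpha> * k * (b - a) powr (2 + \<alpha>)
      = (b - a)\<^sup>2 / 2 * integral\<^sup>L (U \<Otimes>\<^sub>M U) K - k * ((b - a)\<^sup>2 / 2 * ?J)"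
    unfolding J by simp
  also have "\<dots> = (b - a)\<^sup>2 / 2 * (integral\<^sup>L (U \<Otimes>\<^sub>M U) K - k * ?J)"
    by (simp only: right_diff_distrib mult.left_commute)
  also have "\<bar>\<dots>\<bar> \<le> (b - a)\<^sup>2 / 2 * (\<epsilon> * ?J)"
    using le by (simp only: abs_mult[of "(b - a)\<^sup>2 / 2"]) simp
  also have "\<dots> = \<epsilon> * ((b - a)\<^sup>2 / 2 * ?J)"
    by (rule mult.left_commute)
  also have "\<dots> = \<epsilon> * a_const \<alpha> * (b - a) powr (2 + \<alpha>)"
    unfolding J by simp
  finally show ?thesis .
qed

section \<open>Riemann sums over regular designs\<close>

lemma a_const_pos: "0 < \<alpha> \<Longrightarrow> 0 < a_const \<alpha>"
  by (simp add: a_const_def)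

lemma integral_Icc_approx_const:
  fixes f :: "real \<Rightarrow> real"
  assumes ab: "a \<le> b" and f: "continuous_on {a..b} f"
    and bound: "\<And>x. x \<in> {a..b} \<Longrightarrow> \<bar>f x - k\<bar> \<le> \<epsilon>"
  shows "\<bar>integral {a..b} f - k * (b - a)\<bar> \<le> \<epsilon> * (b - a)"
proof -
  have "integral {a..b} (\<lambda>x. f x - k) = integral {a..b} f - k * (b - a)"
    using ab f by (simp add: Henstock_Kurzweil_Integration.integral_diff integrable_continuous_real)
  moreover have "norm (integral {a..b} (\<lambda>x. f x - k)) \<le> \<epsilon> * (b - a)"
    using ab f bound by (intro integral_bound continuous_intros) auto
  ultimately show ?thesis by simp
qed

text \<open>The primitive of \<open>h\<close> grows by exactly \<open>1 / N\<close> over each cell,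
  and the mean value theorem rewrites this growth as a value of \<open>h\<close> times the
  length.\<close>

lemma regular_design_cell:
  assumes h: "positive_density h" and T: "regular_design h N t" and i: "i < N"
  shows "0 \<le> t i" "t (Suc i) \<le> 1" "t i < t (Suc i)"
    and "\<exists>\<xi>\<in>{t i..t (Suc i)}. h \<xi> * (t (Suc i) - t i) = 1 / real N"
proof -
  have t0: "t 0 = 0" and tN: "t N = 1" and t: "\<And>i. i < N \<Longrightarrow> t i < t (Suc i)"
    and int: "\<And>i. i \<le> N \<Longrightarrow> (LBINT v:{0..t i}. h v) = real i / real N"
    using T unfolding regular_design_def by auto
  have mono: "t i \<le> t j" if "i \<le> j" "j \<le> N" for i j
    using t that by (rule partition_mono)
  show 1: "0 \<le> t i" "t (Suc i) \<le> 1" "t i < t (Suc i)"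
    using mono[of 0 i] mono[of "Suc i" N] t0 tN t i by auto
  have cont: "continuous_on {0..1} h" using h by (simp add: positive_density_def)
  have H: "integral {0..t j} h = real j / real N" if "j \<le> N" for j
    using int[OF that] mono[of j N] that tN
    by (subst set_lborel_integral_eq_integral[symmetric]) (auto intro: continuous_on_subset[OF cont])
  have "\<exists>\<xi>\<in>{t i<..<t (Suc i)}. integral {0..t (Suc i)} h - integral {0..t i} h = (\<lambda>y. h \<xi> * y) (t (Suc i) - t i)"
  proof (rule mvt_simple[OF 1(3)])
    fix x assume "t i \<le> x" "x \<le> t (Suc i)"
    then have "((\<lambda>x. integral {0..x} h) has_real_derivative h x) (at x within {0..1})"
      using 1 by (intro integral_has_real_derivative cont) auto
    then have "((\<lambda>x. integral {0..x} h) has_real_derivative h x) (at x within {t i..t (Suc i)})"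
      by (rule has_field_derivative_subset) (use 1 in auto)
    then show "((\<lambda>x. integral {0..x} h) has_derivative (*) (h x)) (at x within {t i..t (Suc i)})"
      by (simp add: has_field_derivative_def)
  qed
  then obtain \<xi> where \<xi>: "\<xi> \<in> {t i<..<t (Suc i)}"
    and eq: "integral {0..t (Suc i)} h - integral {0..t i} h = h \<xi> * (t (Suc i) - t i)"
    by blast
  have "h \<xi> * (t (Suc i) - t i) = 1 / real N"
    using eq H[of i] H[of "Suc i"] i by (simp add: diff_divide_distrib[symmetric])
  then show "\<exists>\<xi>\<in>{t i..t (Suc i)}. h \<xi> * (t (Suc i) - t i) = 1 / real N"
    using \<xi> by (intro bexI[of _ \<xi>]) auto
qed

text \<open>In the application \<open>W\<close> is the cell length to the power
  \<open>2 + \<alpha>\<close>, \<open>n\<close> is \<open>N powr (1 + \<alpha>)\<close>,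
  \<open>p\<close> is \<open>h powr (- (1 + \<alpha>))\<close>, and \<open>scale\<close> expresses
  the design condition. Two errors add up: that of the main term for \<open>E\<close>, and that of
  freezing \<open>c\<close> at \<open>a\<close> and \<open>p\<close> at \<xi> under the integral.
  The bound is proportional to the length, hence can be summed over the cells.\<close>

lemma scaled_cell_estimate:
  fixes c p :: "real \<Rightarrow> real"
  assumes ab: "a < b" and cp: "continuous_on {a..b} (\<lambda>x. c x * p x)"
    and C: "\<And>x. x \<in> {a..b} \<Longrightarrow> \<bar>c x\<bar> \<le> C" and P: "0 \<le> p \<xi>" "p \<xi> \<le> P"
    and osc_c: "\<And>x. x \<in> {a..b} \<Longrightarrow> \<bar>c x - c a\<bar> \<le> \<epsilon>"
    and osc_p: "\<And>x. x \<in> {a..b} \<Longrightarrow> \<bar>p x - p \<xi>\<bar> \<le> \<epsilon>"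
    and A: "0 \<le> A" and n: "0 \<le> n" and scale: "n * W = p \<xi> * (b - a)"
    and E: "\<bar>E - A * c a * W\<bar> \<le> \<epsilon> * W"
  shows "\<bar>n * E - A * integral {a..b} (\<lambda>x. c x * p x)\<bar> \<le> \<epsilon> * (P + A * (C + P)) * (b - a)"
proof -
  have \<epsilon>: "0 \<le> \<epsilon>" using osc_c[of a] ab by simp
  have "n * E - A * c a * (n * W) = n * (E - A * c a * W)"
    by (simp add: algebra_simps)
  then have "\<bar>n * E - A * c a * (n * W)\<bar> = n * \<bar>E - A * c a * W\<bar>"
    using n by (simp add: abs_mult)
  also have "\<dots> \<le> n * (\<epsilon> * W)"
    by (rule mult_left_mono[OF E n])
  also have "\<dots> = \<epsilon> * (n * W)" by simp
  also have "\<dots> = \<epsilon> * p \<xi> * (b - a)" unfolding scale by simp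
  also have "\<dots> \<le> \<epsilon> * P * (b - a)"
    using \<epsilon> P ab by (intro mult_right_mono mult_left_mono) auto
  finally have 1: "\<bar>n * E - A * c a * (p \<xi> * (b - a))\<bar> \<le> \<epsilon> * P * (b - a)"
    unfolding scale .
  have "\<bar>integral {a..b} (\<lambda>x. c x * p x) - c a * p \<xi> * (b - a)\<bar> \<le> (\<epsilon> * (C + P)) * (b - a)"
  proof (rule integral_Icc_approx_const)
    fix x assume x: "x \<in> {a..b}"
    \<comment> \<open>One factor is changed at a time; the other is bounded by \<open>C\<close> or
      \<open>P\<close>.\<close>
    have "c x * p x - c a * p \<xi> = c x * (p x - p \<xi>) + (c x - c a) * p \<xi>"
      by (simp add: algebra_simps)
    also have "\<bar>\<dots>\<bar> \<le> \<bar>c x\<bar> * \<bar>p x - p \<xi>\<bar> + \<bar>c x - c a\<bar> * \<bar>p \<xi>\<bar>"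
      by (rule order_trans[OF abs_triangle_ineq]) (simp add: abs_mult)
    also have "\<dots> \<le> C * \<epsilon> + \<epsilon> * P"
      using C[OF x] osc_p[OF x] osc_c[OF x] P \<epsilon> by (intro add_mono mult_mono) auto
    finally show "\<bar>c x * p x - c a * p \<xi>\<bar> \<le> \<epsilon> * (C + P)"
      by (simp add: algebra_simps)
  qed (use ab cp in auto)
  then have "A * \<bar>integral {a..b} (\<lambda>x. c x * p x) - c a * p \<xi> * (b - a)\<bar> \<le> A * ((\<epsilon> * (C + P)) * (b - a))"
    using A by (rule mult_left_mono)
  moreover have "A * integral {a..b} (\<lambda>x. c x * p x) - A * c a * (p \<xi> * (b - a))
      = A * (integral {a..b} (\<lambda>x. c x * p x) - c a * p \<xi> * (b - a))"
    by (simp add: algebra_simps)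
  ultimately have 2: "\<bar>A * integral {a..b} (\<lambda>x. c x * p x) - A * c a * (p \<xi> * (b - a))\<bar> \<le> A * ((\<epsilon> * (C + P)) * (b - a))"
    using A by (simp add: abs_mult)
  have "\<epsilon> * (P + A * (C + P)) * (b - a) = \<epsilon> * P * (b - a) + A * ((\<epsilon> * (C + P)) * (b - a))"
    by (simp add: algebra_simps)
  then show ?thesis using 1 2 by linarith
qed

lemma uniform_modulus_Icc:
  fixes f :: "real \<Rightarrow> real"
  assumes "continuous_on {a..b} f" "0 < \<epsilon>"
  obtains \<delta> where "0 < \<delta>" "\<And>x y. x \<in> {a..b} \<Longrightarrow> y \<in> {a..b} \<Longrightarrow> \<bar>x - y\<bar> < \<delta> \<Longrightarrow> \<bar>f x - f y\<bar> \<le> \<epsilon>"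
  using compact_uniformly_continuous[OF assms(1) compact_Icc] assms(2)
  unfolding uniformly_continuous_on_def dist_real_def
  by (meson that abs_minus_commute less_imp_le)

lemma continuous_bounded_Icc:
  fixes f :: "real \<Rightarrow> real"
  assumes "continuous_on {a..b} f"
  obtains C where "0 < C" "\<And>x. x \<in> {a..b} \<Longrightarrow> \<bar>f x\<bar> \<le> C"
  using compact_imp_bounded[OF compact_continuous_image[OF assms compact_Icc]]
  unfolding bounded_pos by auto

text \<open>Cells shrink uniformly because \<open>h\<close> is bounded away from zero. On each cell
  the scaled error then differs from \<open>A\<close> times the integral of the limit integrand by a
  small multiple of the length, and the lengths add up to 1.\<close>

lemma regular_design_sum_limit:
  fixes E :: "nat \<Rightarrow> nat \<Rightarrow> real" and c h :: "real \<Rightarrow> real"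
  assumes T: "regular_designs h T" and c: "continuous_on {0..1} c" and A: "0 \<le> A"
    and E: "\<And>\<epsilon>. 0 < \<epsilon> \<Longrightarrow> \<exists>\<delta>>0. \<forall>N\<ge>1. \<forall>i<N. T N (Suc i) - T N i < \<delta> \<longrightarrow>
       \<bar>E N i - A * c (T N i) * (T N (Suc i) - T N i) powr (2 + \<alpha>)\<bar> \<le> \<epsilon> * (T N (Suc i) - T N i) powr (2 + \<alpha>)"
  shows "(\<lambda>N. real N powr (1 + \<alpha>) * (\<Sum>i<N. E N i))
     \<longlonglongrightarrow> A * (LBINT t:{0..1}. c t * h t powr (- (1 + \<alpha>)))"
proof -
  define p where "p t = h t powr (- (1 + \<alpha>))" for t
  have dens: "positive_density h" and des: "\<And>N. 1 \<le> N \<Longrightarrow> regular_design h N (T N)"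
    using T unfolding regular_designs_def by auto
  have h: "continuous_on {0..1} h" and hpos: "\<And>t. t \<in> {0..1} \<Longrightarrow> 0 < h t"
    using dens unfolding positive_density_def by auto
  have p: "continuous_on {0..1} p"
    unfolding p_def using hpos by (intro continuous_on_powr h continuous_on_const) force
  have cp: "continuous_on {0..1} (\<lambda>t. c t * p t)"
    by (intro continuous_on_mult c p)
  obtain C where C: "0 < C" "\<And>x. x \<in> {0..1} \<Longrightarrow> \<bar>c x\<bar> \<le> C"
    using continuous_bounded_Icc[OF c] by blast
  obtain P where P: "0 < P" "\<And>x. x \<in> {0..1} \<Longrightarrow> \<bar>p x\<bar> \<le> P"
    using continuous_bounded_Icc[OF p] by blast
  \<comment> \<open>The positive minimum \<open>m\<close> of \<open>h\<close> will bound every cell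
    length by \<open>1 / (m * N)\<close>.\<close>
  obtain x0 where x0: "x0 \<in> {0..1}" "\<And>x. x \<in> {0..1} \<Longrightarrow> h x0 \<le> h x"
    using continuous_attains_inf[OF compact_Icc _ h] by auto
  define m where "m = h x0"
  have m: "0 < m" using hpos x0 by (simp add: m_def)
  define R where "R = P + A * (C + P)"
  have R: "0 < R" using P C A by (simp add: R_def add_pos_nonneg)
  show ?thesis
    unfolding p_def[symmetric]
  proof (rule LIMSEQ_I)
    fix e :: real assume e: "0 < e"
    \<comment> \<open>The errors of all cells sum to at most \<open>\<epsilon> * R\<close>, which is
      half of \<open>e\<close>.\<close>
    define \<epsilon> where "\<epsilon> = e / (2 * R)"
    have \<epsilon>: "0 < \<epsilon>" using e R by (simp add: \<epsilon>_def)
    obtain d1 where d1: "0 < d1" "\<And>x y. x \<in> {0..1} \<Longrightarrow> y \<in> {0..1} \<Longrightarrow> \<bar>x - y\<bar> < d1 \<Longrightarrow> \<bar>c x - c y\<bar> \<le> \<epsilon>"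
      using uniform_modulus_Icc[OF c \<epsilon>] by blast
    obtain d2 where d2: "0 < d2" "\<And>x y. x \<in> {0..1} \<Longrightarrow> y \<in> {0..1} \<Longrightarrow> \<bar>x - y\<bar> < d2 \<Longrightarrow> \<bar>p x - p y\<bar> \<le> \<epsilon>"
      using uniform_modulus_Icc[OF p \<epsilon>] by blast
    obtain d3 where d3: "0 < d3" "\<And>N i. 1 \<le> N \<Longrightarrow> i < N \<Longrightarrow> T N (Suc i) - T N i < d3 \<Longrightarrow>
       \<bar>E N i - A * c (T N i) * (T N (Suc i) - T N i) powr (2 + \<alpha>)\<bar> \<le> \<epsilon> * (T N (Suc i) - T N i) powr (2 + \<alpha>)"
      using E[OF \<epsilon>] by blast
    define d where "d = min d1 (min d2 d3)"
    have d: "0 < d" using d1 d2 d3 by (simp add: d_def)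
    \<comment> \<open>From \<open>N0\<close> on, \<open>1 / (m * N) < d\<close>, so every cell is
      short enough for all three moduli.\<close>
    obtain N0 :: nat where N0: "1 / (m * d) < real N0"
      using reals_Archimedean2 by blast
    show "\<exists>no. \<forall>N\<ge>no. norm (real N powr (1 + \<alpha>) * (\<Sum>i<N. E N i) - A * (LBINT t:{0..1}. c t * p t)) < e"
    proof (intro exI[of _ "max 1 N0"] allI impI)
      fix N assume "max 1 N0 \<le> N"
      then have N: "1 \<le> N" "N0 \<le> N" by auto
      let ?t = "T N" and ?n = "real N powr (1 + \<alpha>)"
      note cell = regular_design_cell[OF dens des[OF N(1)]]
      have t01: "?t 0 = 0" "?t N = 1"
        using des[OF N(1)] by (auto simp: regular_design_def)
      have cell_est: "\<bar>?n * E N i - A * integral {?t i..?t (Suc i)} (\<lambda>x. c x * p x)\<bar> \<le> \<epsilon> * R * (?t (Suc i) - ?t i)"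
        if i: "i < N" for i
      proof -
        obtain \<xi> where \<xi>: "\<xi> \<in> {?t i..?t (Suc i)}" and len: "h \<xi> * (?t (Suc i) - ?t i) = 1 / real N"
          using cell(4)[OF i] by blast
        note t = cell(1-3)[OF i]
        have sub: "{?t i..?t (Suc i)} \<subseteq> {0..1}" using t by auto
        have \<xi>1: "\<xi> \<in> {0..1}" using \<xi> sub by blast
        have "m * (?t (Suc i) - ?t i) \<le> 1 / real N"
          unfolding len[symmetric] m_def using x0(2)[OF \<xi>1] t by (intro mult_right_mono) auto
        also have "\<dots> < m * d"
        proof -
          have "1 < real N0 * (m * d)" using N0 m d by (simp add: pos_divide_less_eq)
          also have "\<dots> \<le> real N * (m * d)" using N m d by (intro mult_right_mono) auto
          finally show ?thesis using N by (simp add: pos_divide_less_eq mult.commute)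
        qed
        finally have small: "?t (Suc i) - ?t i < d" using m by simp
        have "h \<xi> * (real N * (?t (Suc i) - ?t i)) = 1" using len N by (simp add: field_simps)
        then have inv: "real N * (?t (Suc i) - ?t i) = inverse (h \<xi>)"
          by (metis inverse_unique)
        \<comment> \<open>One power of the length is kept as the weight of the Riemann sum; the
          other \<open>1 + \<alpha>\<close> absorb the power of \<open>N\<close> and, by
          \<open>inv\<close>, become \<open>p \<xi>\<close>.\<close>
        have "?n * (?t (Suc i) - ?t i) powr (2 + \<alpha>) = (real N * (?t (Suc i) - ?t i)) powr (1 + \<alpha>) * (?t (Suc i) - ?t i)"
        proof -
          have "(?t (Suc i) - ?t i) powr (2 + \<alpha>) = (?t (Suc i) - ?t i) powr ((1 + \<alpha>) + 1)" by (simp add: add.commute)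
          also have "\<dots> = (?t (Suc i) - ?t i) powr (1 + \<alpha>) * (?t (Suc i) - ?t i)"
            using t by (subst powr_add) simp
          finally show ?thesis using t by (simp add: powr_mult)
        qed
        also have "(real N * (?t (Suc i) - ?t i)) powr (1 + \<alpha>) = p \<xi>"
          unfolding inv p_def powr_minus using hpos[OF \<xi>1] by (simp add: inverse_powr)
        finally have scale: "?n * (?t (Suc i) - ?t i) powr (2 + \<alpha>) = p \<xi> * (?t (Suc i) - ?t i)" .
        show ?thesis
          unfolding R_def
        proof (rule scaled_cell_estimate[OF t(3) continuous_on_subset[OF cp sub] _ _ _ _ _ A _ scale])
          show "\<bar>E N i - A * c (?t i) * (?t (Suc i) - ?t i) powr (2 + \<alpha>)\<bar> \<le> \<epsilon> * (?t (Suc i) - ?t i) powr (2 + \<alpha>)"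
            using small N i by (intro d3(2)) (auto simp: d_def)
          show "p \<xi> \<le> P" using P(2)[OF \<xi>1] by simp
          fix x assume x: "x \<in> {?t i..?t (Suc i)}"
          then have x1: "x \<in> {0..1}" using sub by blast
          show "\<bar>c x\<bar> \<le> C" by (rule C(2)[OF x1])
          show "\<bar>c x - c (?t i)\<bar> \<le> \<epsilon>"
            using x x1 t small by (intro d1(2)) (auto simp: d_def)
          show "\<bar>p x - p \<xi>\<bar> \<le> \<epsilon>"
            using x x1 \<xi> \<xi>1 small by (intro d2(2)) (auto simp: d_def)
        qed (auto simp: p_def)
      qed
      have "(LBINT t:{?t 0..?t N}. c t * p t) = (\<Sum>i<N. LBINT x:{?t i..?t (Suc i)}. c x * p x)"
        using cell(3) unfolding t01
        by (intro set_integral_partition[of N ?t, unfolded t01] borel_integrable_atLeastAtMost' cp)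
      also have "\<dots> = (\<Sum>i<N. integral {?t i..?t (Suc i)} (\<lambda>x. c x * p x))"
        using cell(1,2)
        by (intro sum.cong refl set_lborel_integral_eq_integral continuous_on_subset[OF cp]) auto
      finally have "(LBINT t:{0..1}. c t * p t) = (\<Sum>i<N. integral {?t i..?t (Suc i)} (\<lambda>x. c x * p x))"
        unfolding t01 .
      then have "\<bar>?n * (\<Sum>i<N. E N i) - A * (LBINT t:{0..1}. c t * p t)\<bar>
          = \<bar>\<Sum>i<N. ?n * E N i - A * integral {?t i..?t (Suc i)} (\<lambda>x. c x * p x)\<bar>"
        by (simp add: sum_distrib_left sum_subtractf)
      also have "\<dots> \<le> (\<Sum>i<N. \<epsilon> * R * (?t (Suc i) - ?t i))"
        by (rule order_trans[OF sum_abs], rule sum_mono) (rule cell_est, simp only: lessThan_iff)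
      also have "\<dots> = \<epsilon> * R"
        unfolding sum_distrib_left[symmetric] sum_lessThan_telescope t01 by simp
      also have "\<dots> < e" using e R by (simp add: \<epsilon>_def)
      finally show "norm (?n * (\<Sum>i<N. E N i) - A * (LBINT t:{0..1}. c t * p t)) < e"
        by simp
    qed
  qed
qed

section \<open>The optimal density\<close>

text \<open>The function \<open>y powr p - p * y\<close> decreases up to 1 and increases afterwards,
  which the mean value theorem on either side turns into a strict inequality. Strictness will give
  uniqueness of the minimizer.\<close>

lemma powr_gt_tangent_at_1:
  fixes x p :: real
  assumes "0 < x" "1 < p"
  shows "1 + p * (x - 1) \<le> x powr p" and "x \<noteq> 1 \<Longrightarrow> 1 + p * (x - 1) < x powr p"
proof -
  show strict: "1 + p * (x - 1) < x powr p" if "x \<noteq> 1"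
  proof -
    define g where "g y = y powr p - p * y" for y :: real
    have g': "(g has_real_derivative p * (y powr (p - 1) - 1)) (at y)" if "0 < y" for y
      unfolding g_def using that by (auto intro!: derivative_eq_intros simp: algebra_simps)
    have "g 1 < g x"
    proof (cases "x < 1")
      case True
      have "\<exists>z. x < z \<and> z < 1 \<and> g 1 - g x = (1 - x) * (p * (z powr (p - 1) - 1))"
        using True assms by (intro MVT2 g') auto
      then obtain z where z: "x < z" "z < 1" "g 1 - g x = (1 - x) * (p * (z powr (p - 1) - 1))" by blast
      have "z powr (p - 1) < 1 powr (p - 1)"
        using z assms by (intro powr_less_mono2) auto
      then have "(1 - x) * (p * (z powr (p - 1) - 1)) < 0"
        using True assms by (simp add: mult_pos_neg)
      then show ?thesis using z(3) by simp
    next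
      case False
      then have x: "1 < x" using that by simp
      have "\<exists>z. 1 < z \<and> z < x \<and> g x - g 1 = (x - 1) * (p * (z powr (p - 1) - 1))"
        using x by (intro MVT2 g') auto
      then obtain z where z: "1 < z" "z < x" "g x - g 1 = (x - 1) * (p * (z powr (p - 1) - 1))" by blast
      have "1 powr (p - 1) < z powr (p - 1)"
        using z assms by (intro powr_less_mono2) auto
      then have "0 < (x - 1) * (p * (z powr (p - 1) - 1))"
        using x assms by simp
      then show ?thesis using z(3) by simp
    qed
    then show ?thesis by (simp add: g_def algebra_simps)
  qed
  show "1 + p * (x - 1) \<le> x powr p"
    using strict by (cases "x = 1") auto
qed

text \<open>With \<open>x = q / h\<close> the integrand is \<open>h * x powr p\<close>, and the tangent \<open>h * (1 + p * (x - 1))\<close>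
  integrates to 1 because both densities do.\<close>

lemma density_power_integral_ge:
  fixes q h :: "real \<Rightarrow> real"
  assumes q: "positive_density q" and h: "positive_density h" and p: "1 < p"
  shows "1 \<le> (LBINT t:{0..1}. q t powr p * h t powr (1 - p))"
    and "(LBINT t:{0..1}. q t powr p * h t powr (1 - p)) = 1 \<Longrightarrow> t \<in> {0..1} \<Longrightarrow> h t = q t"
proof -
  note qc = q[unfolded positive_density_def] and hc = h[unfolded positive_density_def]
  \<comment> \<open>The gap between the integrand and its tangent; its integral is the excess of the
    functional over 1.\<close>
  define f where "f t = q t powr p * h t powr (1 - p) - (h t + p * (q t - h t))" for t
  have tangent: "f t = h t * ((q t / h t) powr p - (1 + p * (q t / h t - 1)))" if "t \<in> {0..1}" for t
  proof -
    have pos: "0 < h t" "0 < q t" using that qc hc by auto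
    have "h t powr (1 - p) = h t / h t powr p" using pos by (simp add: powr_diff)
    then have "q t powr p * h t powr (1 - p) = h t * (q t / h t) powr p"
      using pos by (simp add: powr_divide)
    then show ?thesis using pos by (simp add: f_def field_simps)
  qed
  have pos: "0 < h t" "0 < q t" "0 < q t / h t" if "t \<in> {0..1}" for t using that qc hc by auto
  have f_nonneg: "0 \<le> f t" if "t \<in> {0..1}" for t
    unfolding tangent[OF that] using powr_gt_tangent_at_1(1)[OF pos(3)[OF that] p] pos(1)[OF that]
    by (intro mult_nonneg_nonneg) auto
  have cont: "continuous_on {0..1} (\<lambda>t. q t powr p * h t powr (1 - p))"
    using qc hc by (intro continuous_intros) (auto simp: less_imp_neq[symmetric])
  have fcont: "continuous_on {0..1} f"
    unfolding f_def using cont qc hc by (intro continuous_intros) auto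
  have I: "integral {0..1} h = 1" "integral {0..1} q = 1"
    using qc hc set_lborel_integral_eq_integral[of 0 1 h] set_lborel_integral_eq_integral[of 0 1 q] by auto
  have int: "h integrable_on {0..1}" "q integrable_on {0..1}" "(\<lambda>t. q t powr p * h t powr (1 - p)) integrable_on {0..1}"
    using qc hc cont by (auto intro: integrable_continuous_real)
  have "integral {0..1} f = integral {0..1} (\<lambda>t. q t powr p * h t powr (1 - p))
      - (integral {0..1} h + p * (integral {0..1} q - integral {0..1} h))"
  proof (rule integral_unique)
    show "(f has_integral integral {0..1} (\<lambda>t. q t powr p * h t powr (1 - p))
      - (integral {0..1} h + p * (integral {0..1} q - integral {0..1} h))) {0..1}"
      unfolding f_def using int
      by (intro has_integral_diff has_integral_add has_integral_mult_right integrable_integral)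
  qed
  then have eq: "integral {0..1} f = (LBINT t:{0..1}. q t powr p * h t powr (1 - p)) - 1"
    unfolding I set_lborel_integral_eq_integral[OF cont] by simp
  have "0 \<le> integral {0..1} f"
    using f_nonneg fcont by (intro integral_nonneg integrable_continuous_real) auto
  then show "1 \<le> (LBINT t:{0..1}. q t powr p * h t powr (1 - p))"
    using eq by simp
  assume "(LBINT t:{0..1}. q t powr p * h t powr (1 - p)) = 1" and t: "t \<in> {0..1}"
  \<comment> \<open>A continuous nonnegative gap with integral zero vanishes everywhere, and the
    strict Bernoulli inequality then forces \<open>q t / h t = 1\<close>.\<close>
  then have "(f has_integral 0) (cbox 0 1)"
    using eq integrable_integral[OF integrable_continuous_real[OF fcont]] by simp
  then have "f t = 0"
    using t fcont f_nonneg by (intro has_integral_0_cbox_imp_0[of 0 1 f t]) auto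
  then have "q t / h t = 1"
    using tangent[OF t] powr_gt_tangent_at_1(2)[OF pos(3)[OF t] p] pos[OF t] by force
  then show "h t = q t" using pos[OF t] by simp
qed

text \<open>The optimal density is a power of \<open>c\<close> with exponent
  \<open>1 / (2 + \<alpha>)\<close>, divided by \<open>J\<close>; raising it to the power
  \<open>2 + \<alpha>\<close> recovers \<open>c\<close> up to the constant
  \<open>J powr (2 + \<alpha>)\<close>.\<close>

lemma opt_density_properties:
  assumes c: "continuous_on {0..1} c" and cpos: "\<forall>t\<in>{0..1}. 0 < c t" and \<alpha>: "0 < \<alpha>"
  defines "J \<equiv> LBINT \<tau>:{0..1}. c \<tau> powr opt_exponent \<alpha>"
  shows "0 < J"
    and "positive_density (opt_density \<alpha> c)"
    and "\<And>t. t \<in> {0..1} \<Longrightarrow> c t = J powr (2 + \<alpha>) * opt_density \<alpha> c t powr (2 + \<alpha>)"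
proof -
  let ?\<gamma> = "opt_exponent \<alpha>"
  have cont: "continuous_on {0..1} (\<lambda>t. c t powr ?\<gamma>)"
    using cpos by (intro continuous_on_powr c continuous_on_const) force
  have J: "J = integral {0..1} (\<lambda>t. c t powr ?\<gamma>)"
    unfolding J_def by (rule set_lborel_integral_eq_integral[OF cont])
  have "0 \<le> J" unfolding J
    by (intro integral_nonneg integrable_continuous_real cont) auto
  \<comment> \<open>Otherwise the continuous nonnegative integrand would vanish at every point, in
    particular at 0.\<close>
  moreover have "J \<noteq> 0"
  proof
    assume "J = 0"
    then have "((\<lambda>t. c t powr ?\<gamma>) has_integral 0) (cbox 0 1)"
      using integrable_integral[OF integrable_continuous_real[OF cont]] J by simp
    then have "c 0 powr ?\<gamma> = 0"
      using cont by (intro has_integral_0_cbox_imp_0[of 0 1 "\<lambda>t. c t powr ?\<gamma>" 0]) auto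
    then show False using bspec[OF cpos, of 0] by simp
  qed
  ultimately show Jpos: "0 < J" by simp
  have opt: "opt_density \<alpha> c = (\<lambda>t. c t powr ?\<gamma> / J)"
    unfolding opt_density_def J_def by (rule refl)
  have optc: "continuous_on {0..1} (opt_density \<alpha> c)"
    unfolding opt using Jpos by (intro continuous_intros cont) auto
  show "positive_density (opt_density \<alpha> c)"
    unfolding positive_density_def
  proof (intro conjI ballI optc)
    show "0 < opt_density \<alpha> c t" if "t \<in> {0..1}" for t
      unfolding opt using Jpos bspec[OF cpos that] by simp
    show "(LBINT v:{0..1}. opt_density \<alpha> c v) = 1"
      unfolding opt using Jpos by (simp add: J_def[symmetric])
  qed
  fix t :: real assume t: "t \<in> {0..1}"
  have "J powr (2 + \<alpha>) * opt_density \<alpha> c t powr (2 + \<alpha>) = (c t powr ?\<gamma>) powr (2 + \<alpha>)"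
    unfolding opt using Jpos by (simp add: powr_divide)
  also have "\<dots> = c t"
    using \<alpha> bspec[OF cpos t] by (simp add: powr_powr opt_exponent_def)
  finally show "c t = J powr (2 + \<alpha>) * opt_density \<alpha> c t powr (2 + \<alpha>)" by simp
qed

text \<open>The factor in front of the last integral is free of \<open>h\<close>, so minimization
  reduces to \<open>density_power_integral_ge\<close> with exponent \<open>2 + \<alpha>\<close>;
  \<open>- (1 + \<alpha>)\<close> is written as \<open>1 - (2 + \<alpha>)\<close> to match
  it.\<close>

lemma asymptotic_constant_eq:
  assumes c: "continuous_on {0..1} c" and cpos: "\<forall>t\<in>{0..1}. 0 < c t" and \<alpha>: "0 < \<alpha>"
  shows "asymptotic_constant \<alpha> c h = a_const \<alpha> * (LBINT \<tau>:{0..1}. c \<tau> powr opt_exponent \<alpha>) powr (2 + \<alpha>)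
     * (LBINT t:{0..1}. opt_density \<alpha> c t powr (2 + \<alpha>) * h t powr (1 - (2 + \<alpha>)))"
proof -
  define J where "J = (LBINT \<tau>:{0..1}. c \<tau> powr opt_exponent \<alpha>)"
  note opt = opt_density_properties[OF c cpos \<alpha>, folded J_def]
  have "(LBINT t:{0..1}. c t * h t powr (- (1 + \<alpha>)))
      = (LBINT t:{0..1}. J powr (2 + \<alpha>) * (opt_density \<alpha> c t powr (2 + \<alpha>) * h t powr (1 - (2 + \<alpha>))))"
  proof (rule set_lebesgue_integral_cong, simp, intro allI impI)
    fix t :: real assume "t \<in> {0..1}"
    from opt(3)[OF this] show "c t * h t powr (- (1 + \<alpha>)) = J powr (2 + \<alpha>) * (opt_density \<alpha> c t powr (2 + \<alpha>) * h t powr (1 - (2 + \<alpha>)))"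
      by (simp add: algebra_simps)
  qed
  then show ?thesis
    unfolding asymptotic_constant_def J_def[symmetric] by simp
qed

text \<open>For \<open>h\<close> equal to the optimal density the two exponents add up to 1, so the
  remaining integral is its total mass.\<close>

lemma asymptotic_constant_opt_density:
  assumes c: "continuous_on {0..1} c" and cpos: "\<forall>t\<in>{0..1}. 0 < c t" and \<alpha>: "0 < \<alpha>"
  shows "asymptotic_constant \<alpha> c (opt_density \<alpha> c) = a_const \<alpha> * (LBINT \<tau>:{0..1}. c \<tau> powr opt_exponent \<alpha>) powr (2 + \<alpha>)"
proof -
  have dens: "positive_density (opt_density \<alpha> c)"
    by (rule opt_density_properties(2)[OF c cpos \<alpha>])
  have "(LBINT t:{0..1}. opt_density \<alpha> c t powr (2 + \<alpha>) * opt_density \<alpha> c t powr (1 - (2 + \<alpha>))) = (LBINT t:{0..1}. opt_density \<alpha> c t)"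
  proof (rule set_lebesgue_integral_cong, simp, intro allI impI)
    fix t :: real assume "t \<in> {0..1}"
    then have "0 < opt_density \<alpha> c t" using dens by (simp add: positive_density_def)
    then show "opt_density \<alpha> c t powr (2 + \<alpha>) * opt_density \<alpha> c t powr (1 - (2 + \<alpha>)) = opt_density \<alpha> c t"
      by (simp add: powr_add[symmetric])
  qed
  also have "\<dots> = 1" using dens by (simp add: positive_density_def)
  finally show ?thesis
    unfolding asymptotic_constant_eq[OF c cpos \<alpha>] by (simp only: mult_1_right)
qed

text \<open>Both claims transfer \<open>density_power_integral_ge\<close> through a positive factor.
  An inequality suffices as premise of the second, since with the first it amounts to
  equality.\<close>

lemma opt_density_minimizes:
  assumes c: "continuous_on {0..1} c" and cpos: "\<forall>t\<in>{0..1}. 0 < c t" and \<alpha>: "0 < \<alpha>"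
    and h: "positive_density h"
  shows "asymptotic_constant \<alpha> c (opt_density \<alpha> c) \<le> asymptotic_constant \<alpha> c h"
    and "asymptotic_constant \<alpha> c h \<le> asymptotic_constant \<alpha> c (opt_density \<alpha> c) \<Longrightarrow> t \<in> {0..1} \<Longrightarrow> h t = opt_density \<alpha> c t"
proof -
  let ?J = "LBINT \<tau>:{0..1}. c \<tau> powr opt_exponent \<alpha>"
  let ?I = "LBINT t:{0..1}. opt_density \<alpha> c t powr (2 + \<alpha>) * h t powr (1 - (2 + \<alpha>))"
  have pos: "0 < a_const \<alpha> * ?J powr (2 + \<alpha>)"
    using opt_density_properties(1)[OF c cpos \<alpha>] a_const_pos[OF \<alpha>] by simp
  have p: "1 < 2 + \<alpha>" using \<alpha> by simp
  note ge = density_power_integral_ge[OF opt_density_properties(2)[OF c cpos \<alpha>] h p]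
  have eqs: "asymptotic_constant \<alpha> c (opt_density \<alpha> c) = a_const \<alpha> * ?J powr (2 + \<alpha>) * 1"
    "asymptotic_constant \<alpha> c h = a_const \<alpha> * ?J powr (2 + \<alpha>) * ?I"
    using asymptotic_constant_opt_density[OF c cpos \<alpha>] asymptotic_constant_eq[OF c cpos \<alpha>] by auto
  show "asymptotic_constant \<alpha> c (opt_density \<alpha> c) \<le> asymptotic_constant \<alpha> c h"
    unfolding eqs using ge(1) pos by (intro mult_left_mono) auto
  assume "asymptotic_constant \<alpha> c h \<le> asymptotic_constant \<alpha> c (opt_density \<alpha> c)" and t: "t \<in> {0..1}"
  then have "?I \<le> 1"
    unfolding eqs using pos by (subst (asm) mult_le_cancel_left_pos)
  then show "h t = opt_density \<alpha> c t"
    using ge t by (intro ge(2)) auto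
qed

section \<open>Locally stationary processes\<close>

text \<open>Composing the process with the retraction of the line onto \<open>[0,1]\<close> makes it measurable and
  bounded in mean square on all of \<open>\<real>\<close>, so that no restricted measures are needed.\<close>

definition clamp01 :: "real \<Rightarrow> real" where
  "clamp01 t = max 0 (min 1 t)"

lemma clamp01_in: "clamp01 t \<in> {0..1}"
  by (auto simp: clamp01_def)

lemma clamp01_id: "t \<in> {0..1} \<Longrightarrow> clamp01 t = t"
  by (auto simp: clamp01_def)

lemma jointly_measurable_clamp:
  assumes "jointly_measurable F X"
  shows "(\<lambda>(t, \<omega>). X (clamp01 t) \<omega>) \<in> borel_measurable (borel \<Otimes>\<^sub>M F)"
proof -
  have [measurable]: "clamp01 \<in> measurable borel (restrict_space borel {0..1})"
    by (rule measurable_restrict_space2) (auto simp: clamp01_def[abs_def])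
  have "(\<lambda>z. (clamp01 (fst z), snd z)) \<in> measurable (borel \<Otimes>\<^sub>M F) (restrict_space borel {0..1} \<Otimes>\<^sub>M F)"
    by measurable
  from measurable_compose[OF this assms[unfolded jointly_measurable_def]]
  show ?thesis by (simp add: case_prod_unfold)
qed

section \<open>Uniform estimates from local stationarity\<close>

lemma l2_norm_square: "(l2_norm M \<xi>)\<^sup>2 = (LINT \<omega>|M. (\<xi> \<omega>)\<^sup>2)"
  by (simp add: l2_norm_def integral_nonneg)

text \<open>The ratio limit multiplied out, with \<open>c\<close> frozen at a third point
  \<open>r\<close>, so that a whole cell can use the value at its left endpoint. Half of \<epsilon>
  pays for the ratio and half for the oscillation of \<open>c\<close>.\<close>

lemma locally_stationary_uniform:
  assumes ls: "locally_stationary M X \<alpha> c" and \<epsilon>: "0 < \<epsilon>"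
  shows "\<exists>\<delta>>0. \<forall>s\<in>{0..1}. \<forall>t\<in>{0..1}. \<forall>r\<in>{0..1}. \<bar>s - t\<bar> < \<delta> \<longrightarrow> \<bar>t - r\<bar> < \<delta> \<longrightarrow>
    \<bar>(LINT \<omega>|M. (X s \<omega> - X t \<omega>)\<^sup>2) - c r * \<bar>s - t\<bar> powr \<alpha>\<bar> \<le> \<epsilon> * \<bar>s - t\<bar> powr \<alpha>"
proof -
  have c: "continuous_on {0..1} c" and cpos: "\<And>t. t \<in> {0..1} \<Longrightarrow> 0 < c t"
    and lim: "\<And>\<epsilon>. 0 < \<epsilon> \<Longrightarrow> \<exists>\<delta>>0. \<forall>t s. t \<in> {0..1} \<longrightarrow> t + s \<in> {0..1} \<longrightarrow> 0 < \<bar>s\<bar> \<longrightarrow> \<bar>s\<bar> < \<delta> \<longrightarrow>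
        \<bar>(l2_norm M (\<lambda>\<omega>. X (t + s) \<omega> - X t \<omega>))\<^sup>2 / (c t * \<bar>s\<bar> powr \<alpha>) - 1\<bar> < \<epsilon>"
    using ls unfolding locally_stationary_def by auto
  obtain C where C: "0 < C" "\<And>x. x \<in> {0..1} \<Longrightarrow> \<bar>c x\<bar> \<le> C"
    using continuous_bounded_Icc[OF c] by blast
  obtain d1 where d1: "0 < d1" "\<And>x y. x \<in> {0..1} \<Longrightarrow> y \<in> {0..1} \<Longrightarrow> \<bar>x - y\<bar> < d1 \<Longrightarrow> \<bar>c x - c y\<bar> \<le> \<epsilon> / 2"
    using uniform_modulus_Icc[OF c, of "\<epsilon> / 2"] \<epsilon> by auto
  \<comment> \<open>Dividing by \<open>C\<close> compensates for the later multiplication by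
    \<open>c t\<close>, which is at most \<open>C\<close>.\<close>
  obtain d2 where d2: "0 < d2" "\<And>t s. t \<in> {0..1} \<Longrightarrow> t + s \<in> {0..1} \<Longrightarrow> 0 < \<bar>s\<bar> \<Longrightarrow> \<bar>s\<bar> < d2 \<Longrightarrow>
        \<bar>(l2_norm M (\<lambda>\<omega>. X (t + s) \<omega> - X t \<omega>))\<^sup>2 / (c t * \<bar>s\<bar> powr \<alpha>) - 1\<bar> < \<epsilon> / (2 * C)"
    using lim[of "\<epsilon> / (2 * C)"] \<epsilon> C by auto
  show ?thesis
  proof (intro exI[of _ "min d1 d2"] conjI ballI impI)
    show "0 < min d1 d2" using d1 d2 by simp
    fix s t r :: real
    assume s: "s \<in> {0..1}" and t: "t \<in> {0..1}" and r: "r \<in> {0..1}"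
      and st: "\<bar>s - t\<bar> < min d1 d2" and tr: "\<bar>t - r\<bar> < min d1 d2"
    let ?K = "LINT \<omega>|M. (X s \<omega> - X t \<omega>)\<^sup>2" and ?p = "\<bar>s - t\<bar> powr \<alpha>"
    show "\<bar>?K - c r * ?p\<bar> \<le> \<epsilon> * ?p"
    \<comment> \<open>On the diagonal both sides are zero, since
      \<open>0 powr \<alpha> = 0\<close>.\<close>
    proof (cases "s = t")
      case False
      have p: "0 < ?p" using False by simp
      have "\<bar>?K / (c t * ?p) - 1\<bar> < \<epsilon> / (2 * C)"
        using d2(2)[of t "s - t"] s t st False by (simp add: l2_norm_square)
      then have "c t * ?p * \<bar>?K / (c t * ?p) - 1\<bar> \<le> c t * ?p * (\<epsilon> / (2 * C))"
        using cpos[OF t] p by (intro mult_left_mono) auto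
      also have "c t * ?p * \<bar>?K / (c t * ?p) - 1\<bar> = \<bar>c t * ?p * (?K / (c t * ?p) - 1)\<bar>"
        using cpos[OF t] p by (simp add: abs_mult)
      also have "c t * ?p * (?K / (c t * ?p) - 1) = ?K - c t * ?p"
        using cpos[OF t] p by (simp add: right_diff_distrib)
      also have "c t * ?p * (\<epsilon> / (2 * C)) \<le> C * ?p * (\<epsilon> / (2 * C))"
        using C(1) C(2)[OF t] \<epsilon> p by (intro mult_right_mono) auto
      also have "\<dots> = \<epsilon> / 2 * ?p" using C(1) by simp
      finally have 1: "\<bar>?K - c t * ?p\<bar> \<le> \<epsilon> / 2 * ?p" .
      have "\<bar>c t * ?p - c r * ?p\<bar> = \<bar>c t - c r\<bar> * ?p"
        by (simp add: left_diff_distrib[symmetric] abs_mult)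
      also have "\<dots> \<le> \<epsilon> / 2 * ?p"
        using d1(2)[OF t r] tr p by (intro mult_right_mono) auto
      finally have "\<bar>c t * ?p - c r * ?p\<bar> \<le> \<epsilon> / 2 * ?p" .
      moreover have "\<epsilon> * ?p = \<epsilon> / 2 * ?p + \<epsilon> / 2 * ?p" by simp
      ultimately show ?thesis using 1 by linarith
    qed simp
  qed
qed

text \<open>Over a distance below \<delta> the second moment at most doubles, up to an additive
  constant. A finite cover of [0,1] by balls of radius \<delta> thus reduces the bound to finitely
  many centres.\<close>

lemma second_moment_bounded:
  assumes M: "prob_space M" and jm: "jointly_measurable M X"
    and int: "\<forall>t\<in>{0..1}. integrable M (\<lambda>\<omega>. (X t \<omega>)\<^sup>2)"
    and ls: "locally_stationary M X \<alpha> c" and \<alpha>: "0 < \<alpha>"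
  shows "\<exists>B. \<forall>t\<in>{0..1}. (LINT \<omega>|M. (X t \<omega>)\<^sup>2) \<le> B"
proof -
  have meas[measurable]: "X t \<in> borel_measurable M" if "t \<in> {0..1}" for t
  proof -
    have "(\<lambda>\<omega>. (t, \<omega>)) \<in> measurable M (restrict_space borel {0..1} \<Otimes>\<^sub>M M)"
      using that by (intro measurable_Pair) (auto simp: space_restrict_space)
    from measurable_compose[OF this jm[unfolded jointly_measurable_def]] show ?thesis by simp
  qed
  have c: "continuous_on {0..1} c" using ls by (simp add: locally_stationary_def)
  obtain C where C: "0 < C" "\<And>x. x \<in> {0..1} \<Longrightarrow> \<bar>c x\<bar> \<le> C"
    using continuous_bounded_Icc[OF c] by blast
  obtain \<delta> where \<delta>: "0 < \<delta>" "\<forall>s\<in>{0..1}. \<forall>t\<in>{0..1}. \<forall>r\<in>{0..1}. \<bar>s - t\<bar> < \<delta> \<longrightarrow> \<bar>t - r\<bar> < \<delta> \<longrightarrow>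
      \<bar>(LINT \<omega>|M. (X s \<omega> - X t \<omega>)\<^sup>2) - c r * \<bar>s - t\<bar> powr \<alpha>\<bar> \<le> 1 * \<bar>s - t\<bar> powr \<alpha>"
    using locally_stationary_uniform[OF ls zero_less_one] by blast
  have step: "(LINT \<omega>|M. (X s \<omega>)\<^sup>2) \<le> 2 * (LINT \<omega>|M. (X t \<omega>)\<^sup>2) + 2 * (C + 1)"
    if s: "s \<in> {0..1}" and t: "t \<in> {0..1}" and st: "\<bar>s - t\<bar> < \<delta>" for s t
  proof -
    have mult: "integrable M (\<lambda>\<omega>. X s \<omega> * X t \<omega>)"
      by (rule integrable_mult_if_square_integrable) (use s t int meas in auto)
    have diff: "integrable M (\<lambda>\<omega>. (X s \<omega> - X t \<omega>)\<^sup>2)"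
      unfolding power2_diff mult.assoc using bspec[OF int s] bspec[OF int t] mult
      by (intro Bochner_Integration.integrable_add Bochner_Integration.integrable_diff integrable_mult_right) auto
    have "(LINT \<omega>|M. (X s \<omega>)\<^sup>2) \<le> (LINT \<omega>|M. 2 * (X t \<omega>)\<^sup>2 + 2 * (X s \<omega> - X t \<omega>)\<^sup>2)"
    proof (rule integral_mono)
      fix \<omega>
      \<comment> \<open>The right side exceeds the left by exactly the square of
        \<open>X s \<omega> - 2 * X t \<omega>\<close>.\<close>
      show "(X s \<omega>)\<^sup>2 \<le> 2 * (X t \<omega>)\<^sup>2 + 2 * (X s \<omega> - X t \<omega>)\<^sup>2"
        using zero_le_power2[of "X s \<omega> - 2 * X t \<omega>"] by (simp add: power2_eq_square algebra_simps)
    qed (use bspec[OF int s] bspec[OF int t] diff in auto)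
    also have "\<dots> = 2 * (LINT \<omega>|M. (X t \<omega>)\<^sup>2) + 2 * (LINT \<omega>|M. (X s \<omega> - X t \<omega>)\<^sup>2)"
      using bspec[OF int t] diff by simp
    also have "(LINT \<omega>|M. (X s \<omega> - X t \<omega>)\<^sup>2) \<le> C + 1"
    proof -
      have "\<bar>s - t\<bar> powr \<alpha> \<le> 1 powr \<alpha>"
        using s t \<alpha> by (intro powr_mono2) auto
      then have "(c t + 1) * \<bar>s - t\<bar> powr \<alpha> \<le> (C + 1) * 1"
        using C(1) C(2)[OF t] by (intro mult_mono) auto
      moreover have "\<bar>(LINT \<omega>|M. (X s \<omega> - X t \<omega>)\<^sup>2) - c t * \<bar>s - t\<bar> powr \<alpha>\<bar> \<le> 1 * \<bar>s - t\<bar> powr \<alpha>"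
        using \<delta>(2)[rule_format, OF s t t st] \<delta>(1) by simp
      ultimately show ?thesis by (simp add: algebra_simps)
    qed
    finally show ?thesis by simp
  qed
  obtain D where D: "D \<subseteq> {0..1::real}" "finite D" "{0..1} \<subseteq> (\<Union>t\<in>D. ball t \<delta>)"
    by (rule compactE_image[of "{0..1::real}" "{0..1}" "\<lambda>t. ball t \<delta>"]) (use \<delta>(1) in auto)
  show ?thesis
  proof (intro exI ballI)
    fix s :: real assume s: "s \<in> {0..1}"
    then obtain t where t: "t \<in> D" "\<bar>s - t\<bar> < \<delta>"
      using D(3) by (auto simp: dist_real_def abs_minus_commute)
    have "(LINT \<omega>|M. (X s \<omega>)\<^sup>2) \<le> 2 * (LINT \<omega>|M. (X t \<omega>)\<^sup>2) + 2 * (C + 1)"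
      using s t D(1) by (intro step) auto
    \<comment> \<open>The sum over the centres stands in for their maximum.\<close>
    also have "(LINT \<omega>|M. (X t \<omega>)\<^sup>2) \<le> (\<Sum>t\<in>D. LINT \<omega>|M. (X t \<omega>)\<^sup>2)"
      using t D(2) by (intro member_le_sum) auto
    finally show "(LINT \<omega>|M. (X s \<omega>)\<^sup>2) \<le> 2 * (\<Sum>t\<in>D. LINT \<omega>|M. (X t \<omega>)\<^sup>2) + 2 * (C + 1)"
      by simp
  qed
qed

text \<open>The exact formula is applied to the clamped process. Clamping leaves the error unchanged
  at every \<omega>: the integral runs over [0,1], and the points lie in their cells everywhere on
  the space.\<close>

lemma mean_square_error_stratified:
  assumes M: "prob_space M"
    and int: "\<forall>t\<in>{0..1}. integrable M (\<lambda>\<omega>. (X t \<omega>)\<^sup>2)"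
    and B: "\<forall>t\<in>{0..1}. (LINT \<omega>|M. (X t \<omega>)\<^sup>2) \<le> B"
    and h: "positive_density h" and T: "regular_design h N t" and N: "1 \<le> N"
    and \<eta>: "stratified_points M X N t \<eta>"
  defines "U \<equiv> \<lambda>i. uniform_measure lborel {t i..t (Suc i)}"
    and "K \<equiv> \<lambda>z. LINT \<omega>|M. (X (clamp01 (fst z)) \<omega> - X (clamp01 (snd z)) \<omega>)\<^sup>2"
  shows "mean_square_error M X N t \<eta> = (\<Sum>i<N. (t (Suc i) - t i)\<^sup>2 * integral\<^sup>L (U i \<Otimes>\<^sub>M U i) K / 2)"
    and "i < N \<Longrightarrow> integrable (U i \<Otimes>\<^sub>M U i) K"
proof -
  obtain F where F: "subalgebra M F" "jointly_measurable F X"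
    "prob_space.indep_set M (sets F)
          (sets (vimage_algebra (space M) (\<lambda>\<omega>. \<lambda>i\<in>{..<N}. \<eta> i \<omega>) (Pi\<^sub>M {..<N} (\<lambda>_. borel))))"
    using \<eta> unfolding stratified_points_def by blast
  interpret square_integrable_field M F "\<lambda>t. X (clamp01 t)" B
  proof (intro square_integrable_field.intro M square_integrable_field_axioms.intro)
    show "integrable M (\<lambda>\<omega>. (X (clamp01 t) \<omega>)\<^sup>2)" for t
      using int clamp01_in by blast
    show "(LINT \<omega>|M. (X (clamp01 t) \<omega>)\<^sup>2) \<le> B" for t
      using B clamp01_in by blast
  qed (use F jointly_measurable_clamp in auto)
  note cell = regular_design_cell[OF h T]
  have t01: "t 0 = 0" "t N = 1" using T by (auto simp: regular_design_def)
  have "expectation (\<lambda>\<omega>. ((LBINT x:{t 0..t N}. X (clamp01 x) \<omega>) - (\<Sum>i<N. X (clamp01 (\<eta> i \<omega>)) \<omega> * (t (Suc i) - t i)))\<^sup>2)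
     = (\<Sum>i<N. (t (Suc i) - t i)\<^sup>2 * integral\<^sup>L (U i \<Otimes>\<^sub>M U i) K / 2)"
    unfolding U_def K_def
    by (rule stratified_mean_square_error) (use cell(3) \<eta> F(3) N in \<open>auto simp: stratified_points_def\<close>)
  moreover have "mean_square_error M X N t \<eta>
     = expectation (\<lambda>\<omega>. ((LBINT x:{t 0..t N}. X (clamp01 x) \<omega>) - (\<Sum>i<N. X (clamp01 (\<eta> i \<omega>)) \<omega> * (t (Suc i) - t i)))\<^sup>2)"
    unfolding mean_square_error_def l2_norm_square
  proof (rule Bochner_Integration.integral_cong[OF refl])
    fix \<omega> assume \<omega>: "\<omega> \<in> space M"
    have "process_integral X \<omega> = (LBINT x:{t 0..t N}. X (clamp01 x) \<omega>)"
      unfolding process_integral_def t01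
      by (rule set_lebesgue_integral_cong) (auto simp: clamp01_id)
    moreover have "quadrature X N t \<eta> \<omega> = (\<Sum>i<N. X (clamp01 (\<eta> i \<omega>)) \<omega> * (t (Suc i) - t i))"
      unfolding quadrature_def
    proof (rule sum.cong[OF refl])
      fix i assume "i \<in> {..<N}"
      then have i: "i < N" by simp
      have "\<eta> i \<omega> \<in> {t i..t (Suc i)}"
        using \<eta> i \<omega> by (auto simp: stratified_points_def)
      then have "\<eta> i \<omega> \<in> {0..1}" using cell(1,2)[OF i] by auto
      then show "X (\<eta> i \<omega>) \<omega> * (t (Suc i) - t i) = X (clamp01 (\<eta> i \<omega>)) \<omega> * (t (Suc i) - t i)"
        by (simp only: clamp01_id)
    qed
    ultimately show "(process_integral X \<omega> - quadrature X N t \<eta> \<omega>)\<^sup>2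
      = ((LBINT x:{t 0..t N}. X (clamp01 x) \<omega>) - (\<Sum>i<N. X (clamp01 (\<eta> i \<omega>)) \<omega> * (t (Suc i) - t i)))\<^sup>2"
      by simp
  qed
  ultimately show "mean_square_error M X N t \<eta> = (\<Sum>i<N. (t (Suc i) - t i)\<^sup>2 * integral\<^sup>L (U i \<Otimes>\<^sub>M U i) K / 2)"
    by simp
  show "integrable (U i \<Otimes>\<^sub>M U i) K" if "i < N"
    unfolding U_def K_def by (rule mean_path_variance(2)[OF uniform_measure_Icc_laws[OF cell(3)[OF that]]])
qed

text \<open>\<open>E N i\<close> is the exact contribution of a cell. Local stationarity and
  \<open>cell_error_estimate\<close> supply the uniform cell asymptotics that
  \<open>regular_design_sum_limit\<close> asks for.\<close>

lemma stratified_error_asymptotics: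
  assumes M: "prob_space M" and \<alpha>: "0 < \<alpha>" and qm: "qm_continuous_process M X"
    and ls: "locally_stationary M X \<alpha> c"
    and T: "regular_designs h T" and \<eta>: "\<And>N. 1 \<le> N \<Longrightarrow> stratified_points M X N (T N) (\<eta> N)"
  shows "(\<lambda>N. real N powr (1 + \<alpha>) * mean_square_error M X N (T N) (\<eta> N))
          \<longlonglongrightarrow> asymptotic_constant \<alpha> c h"
proof -
  have int: "\<forall>t\<in>{0..1}. integrable M (\<lambda>\<omega>. (X t \<omega>)\<^sup>2)"
    using qm by (simp add: qm_continuous_process_def)
  obtain B where B: "\<forall>t\<in>{0..1}. (LINT \<omega>|M. (X t \<omega>)\<^sup>2) \<le> B"
    using second_moment_bounded[OF M _ int ls \<alpha>] qm unfolding qm_continuous_process_def by blast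
  have h: "positive_density h" and des: "\<And>N. 1 \<le> N \<Longrightarrow> regular_design h N (T N)"
    using T unfolding regular_designs_def by auto
  have c: "continuous_on {0..1} c" using ls by (simp add: locally_stationary_def)
  define U where "U N i = uniform_measure lborel {T N i..T N (Suc i)}" for N i
  define K where "K = (\<lambda>z. LINT \<omega>|M. (X (clamp01 (fst z)) \<omega> - X (clamp01 (snd z)) \<omega>)\<^sup>2)"
  define E where "E N i = (T N (Suc i) - T N i)\<^sup>2 * integral\<^sup>L (U N i \<Otimes>\<^sub>M U N i) K / 2" for N i
  note mse = mean_square_error_stratified[OF M int B h des _ \<eta>, folded K_def U_def E_def]
  have "(\<lambda>N. real N powr (1 + \<alpha>) * (\<Sum>i<N. E N i))
     \<longlonglongrightarrow> a_const \<alpha> * (LBINT t:{0..1}. c t * h t powr (- (1 + \<alpha>)))"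
  proof (rule regular_design_sum_limit[OF T c less_imp_le[OF a_const_pos[OF \<alpha>]]])
    fix \<epsilon> :: real assume \<epsilon>: "0 < \<epsilon>"
    \<comment> \<open>The division by \<open>a_const \<alpha>\<close> cancels the same factor in the
      bound of \<open>cell_error_estimate\<close>.\<close>
    obtain \<delta> where \<delta>: "0 < \<delta>" "\<And>s t r. s \<in> {0..1} \<Longrightarrow> t \<in> {0..1} \<Longrightarrow> r \<in> {0..1} \<Longrightarrow> \<bar>s - t\<bar> < \<delta> \<Longrightarrow> \<bar>t - r\<bar> < \<delta> \<Longrightarrow>
      \<bar>(LINT \<omega>|M. (X s \<omega> - X t \<omega>)\<^sup>2) - c r * \<bar>s - t\<bar> powr \<alpha>\<bar> \<le> \<epsilon> / a_const \<alpha> * \<bar>s - t\<bar> powr \<alpha>"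
      using locally_stationary_uniform[OF ls, of "\<epsilon> / a_const \<alpha>"] \<epsilon> a_const_pos[OF \<alpha>] by auto
    have "\<bar>E N i - a_const \<alpha> * c (T N i) * (T N (Suc i) - T N i) powr (2 + \<alpha>)\<bar> \<le> \<epsilon> * (T N (Suc i) - T N i) powr (2 + \<alpha>)"
      if N: "1 \<le> N" and i: "i < N" and small: "T N (Suc i) - T N i < \<delta>" for N i
    proof -
      note cell = regular_design_cell[OF h des[OF N] i]
      have "\<bar>E N i - a_const \<alpha> * c (T N i) * (T N (Suc i) - T N i) powr (2 + \<alpha>)\<bar>
         \<le> \<epsilon> / a_const \<alpha> * a_const \<alpha> * (T N (Suc i) - T N i) powr (2 + \<alpha>)"
        unfolding E_def U_def
      proof (rule cell_error_estimate[OF cell(3) \<alpha>])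
        show "integrable (uniform_measure lborel {T N i..T N (Suc i)} \<Otimes>\<^sub>M uniform_measure lborel {T N i..T N (Suc i)}) K"
          using mse(2)[OF N N N i] unfolding U_def .
        fix s t assume st: "s \<in> {T N i..T N (Suc i)}" "t \<in> {T N i..T N (Suc i)}"
        then have "s \<in> {0..1}" "t \<in> {0..1}" "T N i \<in> {0..1}" "\<bar>s - t\<bar> < \<delta>" "\<bar>t - T N i\<bar> < \<delta>"
          using cell(1-3) small by auto
        then show "\<bar>K (s, t) - c (T N i) * \<bar>s - t\<bar> powr \<alpha>\<bar> \<le> \<epsilon> / a_const \<alpha> * \<bar>s - t\<bar> powr \<alpha>"
          using \<delta>(2)[of s t "T N i"] by (simp add: K_def clamp01_id)
      qed
      then show ?thesis using a_const_pos[OF \<alpha>] by simp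
    qed
    then show "\<exists>\<delta>>0. \<forall>N\<ge>1. \<forall>i<N. T N (Suc i) - T N i < \<delta> \<longrightarrow>
       \<bar>E N i - a_const \<alpha> * c (T N i) * (T N (Suc i) - T N i) powr (2 + \<alpha>)\<bar> \<le> \<epsilon> * (T N (Suc i) - T N i) powr (2 + \<alpha>)"
      using \<delta>(1) by blast
  qed
  \<comment> \<open>Designs and points are specified only for \<open>N \<ge> 1\<close>, so the two
    sequences are identified from there on.\<close>
  moreover have "eventually (\<lambda>N. real N powr (1 + \<alpha>) * (\<Sum>i<N. E N i)
      = real N powr (1 + \<alpha>) * mean_square_error M X N (T N) (\<eta> N)) sequentially"
    using eventually_ge_at_top[of 1]
  proof eventually_elim
    case (elim N)
    then show ?case using mse(1)[of N] by (simp add: E_def)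
  qed
  ultimately show ?thesis
    unfolding asymptotic_constant_def by (rule Lim_transform_eventually)
qed

text \<open>Uniqueness of the minimizer is asserted on [0,1] only, because neither
  \<open>positive_density\<close> nor \<open>asymptotic_constant\<close> sees values
  elsewhere.\<close>

theorem corollary1:
  fixes M :: "'a measure" and X :: "real \<Rightarrow> 'a \<Rightarrow> real"
    and \<alpha> :: real and c :: "real \<Rightarrow> real"
  assumes "prob_space M"
    and "0 < \<alpha>" and "\<alpha> < 2"
    and "qm_continuous_process M X"
    and "locally_stationary M X \<alpha> c"
  shows
    "(\<forall>h T \<eta>. regular_designs h T \<longrightarrow>
        (\<forall>N\<ge>1. stratified_points M X N (T N) (\<eta> N)) \<longrightarrow>
        (\<lambda>N. real N powr (1 + \<alpha>) * mean_square_error M X N (T N) (\<eta> N))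
          \<longlonglongrightarrow> asymptotic_constant \<alpha> c h) \<and>
     is_arg_min (asymptotic_constant \<alpha> c) positive_density (opt_density \<alpha> c) \<and>
     (\<forall>h. is_arg_min (asymptotic_constant \<alpha> c) positive_density h \<longrightarrow>
        (\<forall>t\<in>{0..1}. h t = opt_density \<alpha> c t)) \<and>
     (\<forall>T \<eta>. regular_designs (opt_density \<alpha> c) T \<longrightarrow>
        (\<forall>N\<ge>1. stratified_points M X N (T N) (\<eta> N)) \<longrightarrow>
        (\<lambda>N. real N powr (1 + \<alpha>) * mean_square_error M X N (T N) (\<eta> N))
          \<longlonglongrightarrow> a_const \<alpha> *
            (LBINT t:{0..1}. c t powr opt_exponent \<alpha>) powr (1 / opt_exponent \<alpha>))"
proof -
  have c: "continuous_on {0..1} c" and cpos: "\<forall>t\<in>{0..1}. 0 < c t"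
    using assms(5) by (auto simp: locally_stationary_def)
  note opt = opt_density_properties(2)[OF c cpos assms(2)]
  note minimal = opt_density_minimizes[OF c cpos assms(2)]
  have lim: "(\<lambda>N. real N powr (1 + \<alpha>) * mean_square_error M X N (T N) (\<eta> N)) \<longlonglongrightarrow> asymptotic_constant \<alpha> c h"
    if "regular_designs h T" "\<forall>N\<ge>1. stratified_points M X N (T N) (\<eta> N)" for h T \<eta>
    using stratified_error_asymptotics[OF assms(1,2,4,5) that(1)] that(2) by blast
  have min: "is_arg_min (asymptotic_constant \<alpha> c) positive_density (opt_density \<alpha> c)"
    unfolding is_arg_min_def using opt minimal(1) by (auto simp: not_less)
  have unique: "h t = opt_density \<alpha> c t"
    if "is_arg_min (asymptotic_constant \<alpha> c) positive_density h" "t \<in> {0..1}" for h t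
    using that opt unfolding is_arg_min_def by (intro minimal(2)) (auto simp: not_less)
  have "1 / opt_exponent \<alpha> = 2 + \<alpha>"
    by (simp add: opt_exponent_def)
  then have opt_value: "asymptotic_constant \<alpha> c (opt_density \<alpha> c)
      = a_const \<alpha> * (LBINT t:{0..1}. c t powr opt_exponent \<alpha>) powr (1 / opt_exponent \<alpha>)"
    using asymptotic_constant_opt_density[OF c cpos assms(2)] by simp
  show ?thesis
    using lim min unique lim[of "opt_density \<alpha> c", unfolded opt_value] by blast
qed

end
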